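(* Let $S$ be a finite set, let $\lambda\in FL(S)^S$, let $t$ be a scalar-valued formal variable, and let $\Gamma_t(\lambda)\in FL(S)^S$ be the (unique) solution of the ordinary differential equation $$\Gamma_0(\lambda)=0\qquad\text{and}\qquad\frac{d\Gamma_t(\lambda)}{dt}=\frac{\mathrm{ad}\,\Gamma_t(\lambda)}{e^{\mathrm{ad}\,\Gamma_t(\lambda)}-1}\left(e^{-t\partial_\lambda}(\lambda)\right).$$ Then $e^{-t\partial_\lambda}=C^{\Gamma_t(\lambda)}$ as automorphisms of $FL(S)$.
   Context: Everything is over $\mathbb Q$. $FL(S)$ is the degree-completed free Lie algebra on the finite set $S$ of degree 1 generators, and $FL(S)^S$ is the set of functions $\lambda=(\lambda_a)_{a\in S}$ with $\lambda_a\in FL(S)$, with the componentwise (direct sum) Lie bracket, with respect to which $\mathrm{ad}$ is taken. For $\lambda\in FL(S)^S$, $\partial_\lambda$ is the unique (continuous) derivation of $FL(S)$ with $\partial_\lambda(a)=[a,\lambda_a]$ for every $a\in S$; it acts on $FL(S)^S$ componentwise. For $\mu\in FL(S)^S$, $C^\mu$ is the automorphism of $FL(S)$ defined on generators by $C^\mu(a)=e^{\mu_a}ae^{-\mu_a}=e^{\mathrm{ad}\,\mu_a}(a)$. Elements depending on $t$ have, in each degree, coefficients that are power series (in fact polynomials) in $t$. *)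

theory Defs
  imports
    "HOL-Library.Function_Algebras"
    "HOL-Library.FuncSet"
    "HOL-Computational_Algebra.Formal_Power_Series"
begin

section \<open>The degree-completed free Lie algebra over the rationals\<close>

text \<open>
  Non-associative monomials form a basis of the free magma algebra, whose elements are encoded
  by their coefficients, as finitely supported functions on monomials.
\<close>

datatype (gens: 'a) lmon = Gen 'a | Br "'a lmon" "'a lmon"

primrec deg :: "'a lmon \<Rightarrow> nat" where
  "deg (Gen a) = 1"
| "deg (Br l r) = deg l + deg r"

definition mmult :: "('a lmon \<Rightarrow> rat) \<Rightarrow> ('a lmon \<Rightarrow> rat) \<Rightarrow> 'a lmon \<Rightarrow> rat" where
  "mmult f g T = (case T of Gen a \<Rightarrow> 0 | Br l r \<Rightarrow> f l * g r)"

definition hcomp :: "nat \<Rightarrow> ('a lmon \<Rightarrow> rat) \<Rightarrow> 'a lmon \<Rightarrow> rat" where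
  "hcomp d f = (\<lambda>T. if deg T = d then f T else 0)"

definition mag_alg :: "('a lmon \<Rightarrow> rat) set" where
  "mag_alg = {f. finite {T. f T \<noteq> 0}}"

text \<open>The degree completion of the free magma algebra: each homogeneous component is finite.\<close>

definition mag_alg_hat :: "('a lmon \<Rightarrow> rat) set" where
  "mag_alg_hat = {f. \<forall>d. hcomp d f \<in> mag_alg}"

text \<open>
  The two-sided ideal of the free magma algebra whose quotient is the free Lie algebra.
\<close>

inductive_set lie_ideal :: "('a lmon \<Rightarrow> rat) set" where
  alt: "x \<in> mag_alg \<Longrightarrow> mmult x x \<in> lie_ideal"
| jacobi: "x \<in> mag_alg \<Longrightarrow> y \<in> mag_alg \<Longrightarrow> z \<in> mag_alg \<Longrightarrow>
    mmult x (mmult y z) + mmult y (mmult z x) + mmult z (mmult x y) \<in> lie_ideal"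
| add: "u \<in> lie_ideal \<Longrightarrow> v \<in> lie_ideal \<Longrightarrow> u + v \<in> lie_ideal"
| scale: "u \<in> lie_ideal \<Longrightarrow> (\<lambda>T. c * u T) \<in> lie_ideal"
| left: "x \<in> mag_alg \<Longrightarrow> u \<in> lie_ideal \<Longrightarrow> mmult x u \<in> lie_ideal"
| right: "x \<in> mag_alg \<Longrightarrow> u \<in> lie_ideal \<Longrightarrow> mmult u x \<in> lie_ideal"

text \<open>
  The ideal is homogeneous, so the degree completion of the quotient is the quotient of the
  degree completion by the elements all of whose homogeneous components lie in the ideal.
\<close>

definition lie_rel :: "('a lmon \<Rightarrow> rat) \<Rightarrow> ('a lmon \<Rightarrow> rat) \<Rightarrow> bool" where
  "lie_rel f g \<longleftrightarrow> f \<in> mag_alg_hat \<and> g \<in> mag_alg_hat \<and> (\<forall>d. hcomp d (f - g) \<in> lie_ideal)"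

lemma hcomp_simps:
  "hcomp d 0 = 0"
  "hcomp d (f + g) = hcomp d f + hcomp d g"
  "hcomp d (f - g) = hcomp d f - hcomp d g"
  "hcomp d (- f) = - hcomp d f"
  "hcomp d (\<lambda>T. c * f T) = (\<lambda>T. c * hcomp d f T)"
  by (auto simp: hcomp_def fun_eq_iff)

lemma hcomp_hcomp: "hcomp d (hcomp e f) = (if d = e then hcomp d f else 0)"
  by (auto simp: hcomp_def fun_eq_iff)

lemma mag_alg_closed:
  "0 \<in> mag_alg"
  "f \<in> mag_alg \<Longrightarrow> g \<in> mag_alg \<Longrightarrow> f + g \<in> mag_alg"
  "f \<in> mag_alg \<Longrightarrow> g \<in> mag_alg \<Longrightarrow> f - g \<in> mag_alg"
  "f \<in> mag_alg \<Longrightarrow> - f \<in> mag_alg"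
  "f \<in> mag_alg \<Longrightarrow> (\<lambda>T. c * f T) \<in> mag_alg"
proof -
  assume f: "f \<in> mag_alg"
  show "- f \<in> mag_alg" "(\<lambda>T. c * f T) \<in> mag_alg"
    using f by (auto simp: mag_alg_def elim: rev_finite_subset)
  assume g: "g \<in> mag_alg"
  have "finite ({T. f T \<noteq> 0} \<union> {T. g T \<noteq> 0})"
    using f g by (simp add: mag_alg_def)
  then show "f + g \<in> mag_alg" "f - g \<in> mag_alg"
    by (auto simp: mag_alg_def intro: rev_finite_subset)
qed (simp add: mag_alg_def)

lemma mag_alg_sum: "(\<And>i. i \<in> I \<Longrightarrow> f i \<in> mag_alg) \<Longrightarrow> sum f I \<in> mag_alg"
  by (induction I rule: infinite_finite_induct) (auto intro: mag_alg_closed)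

lemma mag_alg_mmult:
  assumes "f \<in> mag_alg" "g \<in> mag_alg"
  shows "mmult f g \<in> mag_alg"
proof -
  have "{T. mmult f g T \<noteq> 0} \<subseteq> (\<lambda>(l, r). Br l r) ` ({T. f T \<noteq> 0} \<times> {T. g T \<noteq> 0})"
  proof
    fix T
    assume "T \<in> {T. mmult f g T \<noteq> 0}"
    then show "T \<in> (\<lambda>(l, r). Br l r) ` ({T. f T \<noteq> 0} \<times> {T. g T \<noteq> 0})"
      by (cases T) (auto simp: mmult_def image_iff)
  qed
  then show ?thesis
    using assms by (auto simp: mag_alg_def intro: finite_subset)
qed

lemma mag_alg_hat_closed:
  "0 \<in> mag_alg_hat"
  "f \<in> mag_alg_hat \<Longrightarrow> g \<in> mag_alg_hat \<Longrightarrow> f + g \<in> mag_alg_hat"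
  "f \<in> mag_alg_hat \<Longrightarrow> g \<in> mag_alg_hat \<Longrightarrow> f - g \<in> mag_alg_hat"
  "f \<in> mag_alg_hat \<Longrightarrow> - f \<in> mag_alg_hat"
  "f \<in> mag_alg_hat \<Longrightarrow> (\<lambda>T. c * f T) \<in> mag_alg_hat"
  "f \<in> mag_alg_hat \<Longrightarrow> hcomp d f \<in> mag_alg_hat"
  by (auto simp: mag_alg_hat_def hcomp_simps hcomp_hcomp intro: mag_alg_closed)

lemma lie_ideal_zero: "0 \<in> (lie_ideal :: ('a lmon \<Rightarrow> rat) set)"
proof -
  have "mmult 0 0 \<in> (lie_ideal :: ('a lmon \<Rightarrow> rat) set)"
    by (rule lie_ideal.alt) (rule mag_alg_closed)
  moreover have "mmult 0 0 = (0 :: 'a lmon \<Rightarrow> rat)"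
    by (auto simp: mmult_def fun_eq_iff split: lmon.splits)
  ultimately show ?thesis by simp
qed

lemma lie_ideal_uminus: "u \<in> lie_ideal \<Longrightarrow> - u \<in> lie_ideal"
  using lie_ideal.scale[of u "-1"] by (simp add: fun_Compl_def)

lemma lie_ideal_diff: "u \<in> lie_ideal \<Longrightarrow> v \<in> lie_ideal \<Longrightarrow> u - v \<in> lie_ideal"
  using lie_ideal.add[of u "- v"] lie_ideal_uminus[of v] by simp

lemma lie_ideal_sum: "(\<And>i. i \<in> I \<Longrightarrow> f i \<in> lie_ideal) \<Longrightarrow> sum f I \<in> lie_ideal"
  by (induction I rule: infinite_finite_induct) (auto intro: lie_ideal_zero lie_ideal.add)

lemma sum_fun_apply: "(\<Sum>i\<in>I. f i) x = (\<Sum>i\<in>I. f i x)"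
  by (induction I rule: infinite_finite_induct) auto

lemma hcomp_mmult: "hcomp d (mmult f g) = (\<Sum>i\<le>d. mmult (hcomp i f) (hcomp (d - i) g))"
proof
  fix T
  show "hcomp d (mmult f g) T = (\<Sum>i\<le>d. mmult (hcomp i f) (hcomp (d - i) g)) T"
  proof (cases T)
    case (Gen a)
    then show ?thesis by (simp add: sum_fun_apply hcomp_def mmult_def)
  next
    case (Br l r)
    have "(\<Sum>i\<le>d. mmult (hcomp i f) (hcomp (d - i) g) T) =
        (\<Sum>i\<le>d. if i = deg l then (if deg l + deg r = d then f l * g r else 0) else 0)"
      by (rule sum.cong) (auto simp: Br hcomp_def mmult_def)
    also have "\<dots> = hcomp d (mmult f g) T"
      by (auto simp: Br hcomp_def mmult_def)
    finally show ?thesis by (simp add: sum_fun_apply)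
  qed
qed

lemma mag_alg_hat_mmult: "f \<in> mag_alg_hat \<Longrightarrow> g \<in> mag_alg_hat \<Longrightarrow> mmult f g \<in> mag_alg_hat"
  by (auto simp: mag_alg_hat_def hcomp_mmult intro!: mag_alg_sum mag_alg_mmult)

lemma mmult_diff:
  "mmult f g - mmult f' g' = mmult (f - f') g + mmult f' (g - g')"
  by (auto simp: mmult_def fun_eq_iff algebra_simps split: lmon.splits)

lemma lie_rel_mmult:
  assumes "lie_rel f f'" "lie_rel g g'"
  shows "lie_rel (mmult f g) (mmult f' g')"
proof -
  have "hcomp d (mmult f g - mmult f' g') \<in> lie_ideal" for d
    using assms unfolding mmult_diff hcomp_simps(2) hcomp_mmult
    by (intro lie_ideal.add lie_ideal_sum lie_ideal.left lie_ideal.right)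
       (auto simp: lie_rel_def mag_alg_hat_def)
  then show ?thesis
    using assms by (auto simp: lie_rel_def intro: mag_alg_hat_mmult)
qed

lemma lie_rel_refl: "f \<in> mag_alg_hat \<Longrightarrow> lie_rel f f"
  by (simp add: lie_rel_def hcomp_simps lie_ideal_zero)

text \<open>The degree-completed free Lie algebra on the whole type \<^typ>\<open>'a\<close>.\<close>

quotient_type 'a fl = "'a lmon \<Rightarrow> rat" / partial: lie_rel
proof (rule part_equivpI)
  show "\<exists>f::'a lmon \<Rightarrow> rat. lie_rel f f"
    by (rule exI[of _ 0]) (intro lie_rel_refl mag_alg_hat_closed)
  show "symp (lie_rel :: ('a lmon \<Rightarrow> rat) \<Rightarrow> _)"
  proof (rule sympI)
    fix f g :: "'a lmon \<Rightarrow> rat"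
    assume "lie_rel f g"
    then show "lie_rel g f"
      using lie_ideal_uminus[of "hcomp _ (f - g)"] by (auto simp: lie_rel_def hcomp_simps)
  qed
  show "transp (lie_rel :: ('a lmon \<Rightarrow> rat) \<Rightarrow> _)"
  proof (rule transpI)
    fix f g h :: "'a lmon \<Rightarrow> rat"
    assume fg: "lie_rel f g" and gh: "lie_rel g h"
    have "hcomp d (f - g) + hcomp d (g - h) \<in> lie_ideal" for d
      using fg gh by (intro lie_ideal.add) (auto simp: lie_rel_def)
    then show "lie_rel f h"
      using fg gh by (simp add: lie_rel_def hcomp_simps)
  qed
qed

instantiation fl :: (type) ab_group_add
begin

lift_definition zero_fl :: "'a fl" is 0
  by (intro lie_rel_refl mag_alg_hat_closed)

lift_definition plus_fl :: "'a fl \<Rightarrow> 'a fl \<Rightarrow> 'a fl" is "(+)"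
  subgoal for f f' g g'
    using lie_ideal.add[of "hcomp d (f - f')" "hcomp d (g - g')" for d]
    by (auto simp: lie_rel_def hcomp_simps algebra_simps intro: mag_alg_hat_closed)
  done

lift_definition minus_fl :: "'a fl \<Rightarrow> 'a fl \<Rightarrow> 'a fl" is "(-)"
  subgoal for f f' g g'
    using lie_ideal_diff[of "hcomp d (f - f')" "hcomp d (g - g')" for d]
    by (auto simp: lie_rel_def hcomp_simps algebra_simps intro: mag_alg_hat_closed)
  done

lift_definition uminus_fl :: "'a fl \<Rightarrow> 'a fl" is uminus
  subgoal for f f'
    using lie_ideal_uminus[of "hcomp _ (f - f')"]
    by (auto simp: lie_rel_def hcomp_simps algebra_simps intro: mag_alg_hat_closed)
  done

instance
proof
  fix x y z :: "'a fl"
  show "x + y + z = x + (y + z)"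
    by transfer (auto simp: add.assoc intro!: lie_rel_refl mag_alg_hat_closed simp: lie_rel_def)
  show "x + y = y + x"
    by transfer (auto simp: add.commute intro!: lie_rel_refl mag_alg_hat_closed simp: lie_rel_def)
  show "0 + x = x"
    by transfer simp
  show "- x + x = 0"
    by transfer (auto intro!: lie_rel_refl mag_alg_hat_closed)
  show "x - y = x + - y"
    by transfer (auto intro!: lie_rel_refl mag_alg_hat_closed simp: lie_rel_def)
qed

end

lift_definition fl_gen :: "'a \<Rightarrow> 'a fl" is "\<lambda>a T. if T = Gen a then 1 else 0"
  by (rule lie_rel_refl)
     (auto simp: mag_alg_hat_def mag_alg_def hcomp_def intro: finite_subset[of _ "{Gen _}"])

lift_definition fl_scale :: "rat \<Rightarrow> 'a fl \<Rightarrow> 'a fl" is "\<lambda>c f T. c * f T"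
  subgoal for c f f'
  proof -
    assume *: "lie_rel f f'"
    have "hcomp d ((\<lambda>T. c * f T) - (\<lambda>T. c * f' T)) = (\<lambda>T. c * hcomp d (f - f') T)" for d
      by (auto simp: hcomp_def fun_eq_iff algebra_simps)
    then show ?thesis
      using * by (auto simp: lie_rel_def intro: mag_alg_hat_closed lie_ideal.scale)
  qed
  done

lift_definition fl_br :: "'a fl \<Rightarrow> 'a fl \<Rightarrow> 'a fl" is mmult
  by (rule lie_rel_mmult)

lift_definition fl_comp :: "nat \<Rightarrow> 'a fl \<Rightarrow> 'a fl" is hcomp
  by (auto simp: lie_rel_def hcomp_simps(3)[symmetric] hcomp_hcomp
      intro: mag_alg_hat_closed lie_ideal_zero)

text \<open>
  The completed free Lie algebra on a subset \<open>S\<close> of the type, as the set of classes of series in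
  monomials with all their generators in \<open>S\<close>. (Killing the generators outside \<open>S\<close> maps
  \<^const>\<open>lie_ideal\<close> to its analogue over \<open>S\<close>, so no further relations are imposed.)
\<close>

definition FL :: "'a set \<Rightarrow> 'a fl set" where
  "FL S = {abs_fl f | f. f \<in> mag_alg_hat \<and> (\<forall>T. f T \<noteq> 0 \<longrightarrow> gens T \<subseteq> S)}"

section \<open>Tangential derivations\<close>

text \<open>
  Continuity is with respect to the filtration by degree; for a linear map it is continuity at 0.
\<close>

definition is_cont_derivation :: "'a set \<Rightarrow> ('a fl \<Rightarrow> 'a fl) \<Rightarrow> bool" where
  "is_cont_derivation S D \<longleftrightarrow>
     (\<forall>x\<in>FL S. D x \<in> FL S) \<and>
     (\<forall>x\<in>FL S. \<forall>y\<in>FL S. D (x + y) = D x + D y) \<and>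
     (\<forall>c. \<forall>x\<in>FL S. D (fl_scale c x) = fl_scale c (D x)) \<and>
     (\<forall>x\<in>FL S. \<forall>y\<in>FL S. D (fl_br x y) = fl_br (D x) y + fl_br x (D y)) \<and>
     (\<forall>d. \<exists>e. \<forall>x\<in>FL S. (\<forall>i<e. fl_comp i x = 0) \<longrightarrow> (\<forall>i<d. fl_comp i (D x) = 0))"

definition tder :: "'a set \<Rightarrow> ('a \<Rightarrow> 'a fl) \<Rightarrow> 'a fl \<Rightarrow> 'a fl" where
  "tder S l = (THE D. D \<in> extensional (FL S) \<and> is_cont_derivation S D \<and>
     (\<forall>a\<in>S. D (fl_gen a) = fl_br (fl_gen a) (l a)))"

section \<open>Elements depending on the formal variable t\<close>

text \<open>
  Elements depending on \<open>t\<close> are formal power series in \<open>t\<close> with coefficients in the completed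
  free Lie algebra. For finite \<open>S\<close> the homogeneous components of \<^term>\<open>FL S\<close> are
  finite-dimensional, so these are the elements having in each degree coefficients that are
  power series in \<open>t\<close>.
\<close>

definition FLt :: "'a set \<Rightarrow> 'a fl fps set" where
  "FLt S = {x. \<forall>k. fps_nth x k \<in> FL S}"

definition flt_scale :: "rat fps \<Rightarrow> 'a fl fps \<Rightarrow> 'a fl fps" where
  "flt_scale c x = Abs_fps (\<lambda>k. \<Sum>i\<le>k. fl_scale (fps_nth c i) (fps_nth x (k - i)))"

definition flt_br :: "'a fl fps \<Rightarrow> 'a fl fps \<Rightarrow> 'a fl fps" where
  "flt_br x y = Abs_fps (\<lambda>k. \<Sum>i\<le>k. fl_br (fps_nth x i) (fps_nth y (k - i)))"

definition flt_comp :: "nat \<Rightarrow> 'a fl fps \<Rightarrow> 'a fl fps" where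
  "flt_comp d x = Abs_fps (\<lambda>k. fl_comp d (fps_nth x k))"

definition flt_ddt :: "'a fl fps \<Rightarrow> 'a fl fps" where
  "flt_ddt x = Abs_fps (\<lambda>k. fl_scale (of_nat (k + 1)) (fps_nth x (k + 1)))"

definition flt_tder :: "'a set \<Rightarrow> ('a \<Rightarrow> 'a fl) \<Rightarrow> 'a fl fps \<Rightarrow> 'a fl fps" where
  "flt_tder S l x = Abs_fps (\<lambda>k. tder S l (fps_nth x k))"

text \<open>
  \<open>op_series c P\<close> is the operator \<open>c(P)\<close> obtained by substituting the operator \<open>P\<close> into the
  power series \<open>c\<close>, the sum being a limit in the degree topology.
\<close>

definition deg_tendsto :: "(nat \<Rightarrow> 'a fl fps) \<Rightarrow> 'a fl fps \<Rightarrow> bool" where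
  "deg_tendsto X y \<longleftrightarrow> (\<forall>d. \<forall>\<^sub>F N in sequentially. flt_comp d (X N) = flt_comp d y)"

definition op_series :: "rat fps \<Rightarrow> ('a fl fps \<Rightarrow> 'a fl fps) \<Rightarrow> 'a fl fps \<Rightarrow> 'a fl fps" where
  "op_series c P x =
     (THE y. deg_tendsto (\<lambda>N. \<Sum>n<N. flt_scale (fps_const (fps_nth c n)) ((P ^^ n) x)) y)"

definition exp_minus_t_tder :: "'a set \<Rightarrow> ('a \<Rightarrow> 'a fl) \<Rightarrow> 'a fl fps \<Rightarrow> 'a fl fps" where
  "exp_minus_t_tder S l = op_series (fps_exp 1) (\<lambda>x. flt_scale (- fps_X) (flt_tder S l x))"

definition is_cont_automorphism :: "'a set \<Rightarrow> ('a fl fps \<Rightarrow> 'a fl fps) \<Rightarrow> bool" where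
  "is_cont_automorphism S F \<longleftrightarrow>
     bij_betw F (FLt S) (FLt S) \<and>
     (\<forall>x\<in>FLt S. \<forall>y\<in>FLt S. F (x + y) = F x + F y) \<and>
     (\<forall>c. \<forall>x\<in>FLt S. F (flt_scale c x) = flt_scale c (F x)) \<and>
     (\<forall>x\<in>FLt S. \<forall>y\<in>FLt S. F (flt_br x y) = flt_br (F x) (F y)) \<and>
     (\<forall>d. \<exists>e. \<forall>x\<in>FLt S. (\<forall>i<e. flt_comp i x = 0) \<longrightarrow> (\<forall>i<d. flt_comp i (F x) = 0))"

definition conj_aut :: "'a set \<Rightarrow> ('a \<Rightarrow> 'a fl fps) \<Rightarrow> 'a fl fps \<Rightarrow> 'a fl fps" where
  "conj_aut S m = (THE F. F \<in> extensional (FLt S) \<and> is_cont_automorphism S F \<and>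
     (\<forall>a\<in>S. F (fps_const (fl_gen a)) =
        op_series (fps_exp 1) (flt_br (m a)) (fps_const (fl_gen a))))"

text \<open>
  The bracket on tuples is componentwise, so the differential equation can be read off
  component by component; \<^term>\<open>fps_X / (fps_exp 1 - 1) :: rat fps\<close> is the power series of
  \<open>z / (exp z - 1)\<close>.
\<close>

definition solves_Gamma_ode :: "'a set \<Rightarrow> ('a \<Rightarrow> 'a fl) \<Rightarrow> ('a \<Rightarrow> 'a fl fps) \<Rightarrow> bool" where
  "solves_Gamma_ode S l G \<longleftrightarrow>
     (\<forall>a\<in>S. fps_nth (G a) 0 = 0) \<and>
     (\<forall>a\<in>S. flt_ddt (G a) =
        op_series (fps_X / (fps_exp 1 - 1)) (flt_br (G a))
          (exp_minus_t_tder S l (fps_const (l a))))"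

definition Gamma_t :: "'a set \<Rightarrow> ('a \<Rightarrow> 'a fl) \<Rightarrow> 'a \<Rightarrow> 'a fl fps" where
  "Gamma_t S l = (THE G. G \<in> (S \<rightarrow>\<^sub>E FLt S) \<and> solves_Gamma_ode S l G)"

end

theory Submission
  imports Defs
begin

text \<open>
  Write \<open>D\<close> for the derivation with \<open>a \<mapsto> [a, \<lambda>\<^sub>a]\<close>, \<open>E = exp (- t D)\<close> and \<open>G\<close> for the component at \<open>a\<close>
  of the solution of the differential equation. Since \<open>E\<close> is an automorphism commuting with \<open>D\<close>,
  \<open>y = E a\<close> satisfies \<open>y' = - E [a, \<lambda>\<^sub>a] = [E \<lambda>\<^sub>a, y]\<close>. On the other hand \<open>y = exp (ad G) a\<close> satisfies
  \<open>y' = [((exp (ad G) - 1) / ad G) G', y]\<close>, and the equation for \<open>G\<close> says precisely that the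
  left entry is \<open>E \<lambda>\<^sub>a\<close>. Both series start with \<open>a\<close>, so they agree, and a continuous automorphism
  is determined by its values on the generators.
\<close>

section \<open>The free Lie algebra is a Lie algebra\<close>

text \<open>\<open>tder\<close>, \<open>Gamma_t\<close> and \<open>conj_aut\<close> are definite
  descriptions, so each needs existence and uniqueness. The derivation is the delicate case: it must
  act on infinite series and respect the Lie relations, so it is built coefficientwise on trees and
  then passed to the quotient. Uniqueness on the generators uses that, for finite \<open>S\<close>,
  an element is a finite combination of monomials modulo any degree. The map C^\<Gamma> is never
  built separately: the flow has the prescribed values on generators and is therefore the map
  described. Limits are taken in the degree topology, but \<open>G\<close> has no constant term in t
  and -tD carries a factor t, so each t-coefficient of these operator series is a finite sum.
  Multiplicativity of the flow then follows from its differential equation, coefficient by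
  coefficient, without binomial sums.\<close>

lemma mmult_simps [simp]: "mmult f g (Gen a) = 0" "mmult f g (Br l r) = f l * g r"
  by (simp_all add: mmult_def)

lemma mmult_add_left: "mmult (f + g) h = mmult f h + mmult g h"
  and mmult_add_right: "mmult h (f + g) = mmult h f + mmult h g"
  and mmult_scale_left: "mmult (\<lambda>T. c * f T) h = (\<lambda>T. c * mmult f h T)"
  and mmult_scale_right: "mmult h (\<lambda>T. c * f T) = (\<lambda>T. c * mmult h f T)"
  by (auto simp: mmult_def fun_eq_iff algebra_simps split: lmon.splits)

lemma deg_neq_0 [simp]: "deg T \<noteq> 0"
  by (induction T) auto

lemma hcomp_mag_alg: "f \<in> mag_alg_hat \<Longrightarrow> hcomp d f \<in> mag_alg"
  by (simp add: mag_alg_hat_def)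

lemma mag_alg_subset_hat: "f \<in> mag_alg \<Longrightarrow> f \<in> mag_alg_hat"
  by (auto simp: mag_alg_hat_def mag_alg_def hcomp_def elim: rev_finite_subset)

lemma lie_ideal_swap:
  assumes "u \<in> mag_alg" "v \<in> mag_alg"
  shows "mmult u v + mmult v u \<in> lie_ideal"
proof -
  have "mmult u v + mmult v u = mmult (u + v) (u + v) - mmult u u - mmult v v"
    by (simp add: mmult_add_left mmult_add_right)
  then show ?thesis
    using assms by (auto intro!: lie_ideal_diff lie_ideal.alt mag_alg_closed)
qed

lemma lie_rel_zero_iff:
  "lie_rel f 0 \<longleftrightarrow> f \<in> mag_alg_hat \<and> (\<forall>d. hcomp d f \<in> lie_ideal)"
  by (auto simp: lie_rel_def intro: mag_alg_hat_closed)

text \<open>The rule \<open>alt\<close> covers finite elements only. In degree d the terms i and d -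
  i pair up to symmetrised products of finite homogeneous components, which
  \<open>lie_ideal_swap\<close> handles.\<close>

lemma lie_rel_alt:
  assumes "f \<in> mag_alg_hat"
  shows "lie_rel (mmult f f) 0"
proof -
  have "hcomp d (mmult f f) \<in> lie_ideal" for d
  proof -
    let ?h = "\<lambda>i. mmult (hcomp i f) (hcomp (d - i) f)"
    have "(\<Sum>i\<le>d. ?h i) = (\<Sum>i\<le>d. ?h (d - i))"
      by (rule sum.reindex_bij_witness[of _ "\<lambda>i. d - i" "\<lambda>i. d - i"]) auto
    then have "(\<Sum>i\<le>d. ?h i) + (\<Sum>i\<le>d. ?h i) = (\<Sum>i\<le>d. ?h i + ?h (d - i))"
      by (simp add: sum.distrib)
    also have "\<dots> \<in> lie_ideal"
      using assms by (auto intro!: lie_ideal_sum lie_ideal_swap hcomp_mag_alg)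
    \<comment> \<open>Pairing counts every term twice. Halving over the rationals also treats the
      middle term i = d - i without a case split.\<close>
    finally have "(\<lambda>T. 1/2 * ((\<Sum>i\<le>d. ?h i) + (\<Sum>i\<le>d. ?h i)) T) \<in> lie_ideal"
      by (rule lie_ideal.scale)
    also have "(\<lambda>T. 1/2 * ((\<Sum>i\<le>d. ?h i) + (\<Sum>i\<le>d. ?h i)) T) = (\<Sum>i\<le>d. ?h i)"
      by (simp add: fun_eq_iff)
    finally show ?thesis by (simp add: hcomp_mmult)
  qed
  then show ?thesis
    using assms by (auto simp: lie_rel_zero_iff intro: mag_alg_hat_mmult)
qed

definition deg_triples :: "nat \<Rightarrow> (nat \<times> nat \<times> nat) set" where
  "deg_triples d = {(i, j, k). i + j + k = d}"

lemma finite_deg_triples [simp]: "finite (deg_triples d)"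
  by (rule finite_subset[of _ "{..d} \<times> {..d} \<times> {..d}"]) (auto simp: deg_triples_def)

lemma hcomp_mmult3:
  "hcomp d (mmult f (mmult g h)) =
     (\<Sum>(i, j, k)\<in>deg_triples d. mmult (hcomp i f) (mmult (hcomp j g) (hcomp k h)))"
proof
  fix T
  show "hcomp d (mmult f (mmult g h)) T =
     (\<Sum>(i, j, k)\<in>deg_triples d. mmult (hcomp i f) (mmult (hcomp j g) (hcomp k h))) T"
  proof (cases "\<exists>p q r. T = Br p (Br q r)")
    case True
    then obtain p q r where T: "T = Br p (Br q r)" by blast
    have "(\<Sum>(i, j, k)\<in>deg_triples d. mmult (hcomp i f) (mmult (hcomp j g) (hcomp k h)) T) =
      (\<Sum>t\<in>deg_triples d. if t = (deg p, deg q, deg r) then f p * (g q * h r) else 0)"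
      by (rule sum.cong) (auto simp: T hcomp_def split: if_splits)
    also have "\<dots> = hcomp d (mmult f (mmult g h)) T"
      by (simp only: sum.delta'[OF finite_deg_triples] sum.delta[OF finite_deg_triples])
         (simp add: T hcomp_def deg_triples_def add.assoc)
    finally show ?thesis by (simp add: sum_fun_apply case_prod_unfold)
  next
    case False
    then have "mmult a (mmult b c) T = 0" for a b c :: "'a lmon \<Rightarrow> rat"
      by (auto simp: mmult_def split: lmon.splits)
    then show ?thesis by (simp add: hcomp_def sum_fun_apply case_prod_unfold)
  qed
qed

text \<open>In degree d each double product is a sum over degree triples. Rotating the triples
  cyclically in the second and third sums puts the same three homogeneous components into all three
  terms, where the rule \<open>jacobi\<close> applies.\<close>

lemma lie_rel_jacobi:
  assumes "x \<in> mag_alg_hat" "y \<in> mag_alg_hat" "z \<in> mag_alg_hat"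
  shows "lie_rel (mmult x (mmult y z) + mmult y (mmult z x) + mmult z (mmult x y)) 0"
proof -
  let ?m = "\<lambda>f g h. \<lambda>(i, j, k). mmult (hcomp i f) (mmult (hcomp j g) (hcomp k h))"
  have "hcomp d (mmult x (mmult y z) + mmult y (mmult z x) + mmult z (mmult x y)) \<in> lie_ideal" for d
  proof -
    have 1: "(\<Sum>t\<in>deg_triples d. ?m y z x t) = (\<Sum>(i, j, k)\<in>deg_triples d. ?m y z x (j, k, i))"
      by (rule sum.reindex_bij_witness[of _ "\<lambda>(i, j, k). (j, k, i)" "\<lambda>(j, k, i). (i, j, k)"])
         (auto simp: deg_triples_def)
    have 2: "(\<Sum>t\<in>deg_triples d. ?m z x y t) = (\<Sum>(i, j, k)\<in>deg_triples d. ?m z x y (k, i, j))"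
      by (rule sum.reindex_bij_witness[of _ "\<lambda>(i, j, k). (k, i, j)" "\<lambda>(k, i, j). (i, j, k)"])
         (auto simp: deg_triples_def)
    have "hcomp d (mmult x (mmult y z) + mmult y (mmult z x) + mmult z (mmult x y)) =
        (\<Sum>(i, j, k)\<in>deg_triples d. ?m x y z (i, j, k) + ?m y z x (j, k, i) + ?m z x y (k, i, j))"
      unfolding hcomp_simps hcomp_mmult3 1 2 by (simp add: sum.distrib case_prod_unfold)
    also have "\<dots> \<in> lie_ideal"
      using assms by (auto intro!: lie_ideal_sum lie_ideal.jacobi hcomp_mag_alg)
    finally show ?thesis .
  qed
  then show ?thesis
    using assms by (auto simp: lie_rel_zero_iff intro!: mag_alg_hat_mmult mag_alg_hat_closed)
qed

lemma lie_rel_add: "lie_rel f f' \<Longrightarrow> lie_rel g g' \<Longrightarrow> lie_rel (f + g) (f' + g')"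
  using plus_fl.rsp by (auto simp: rel_fun_def)

lemma lie_rel_scale: "lie_rel f f' \<Longrightarrow> lie_rel (\<lambda>T. c * f T) (\<lambda>T. c * f' T)"
  using fl_scale.rsp by (auto simp: rel_fun_def)

lemma mmult_zero [simp]: "mmult 0 f = 0" "mmult f 0 = 0"
  by (auto simp: mmult_def fun_eq_iff split: lmon.splits)

text \<open>That is, the ideal is homogeneous.\<close>

lemma lie_ideal_imp_lie_rel: "u \<in> lie_ideal \<Longrightarrow> lie_rel u 0"
proof (induction rule: lie_ideal.induct)
  case (add u v)
  then show ?case using lie_rel_add[of u 0 v 0] by (simp add: plus_fun_def zero_fun_def)
next
  case (scale u c)
  then show ?case using lie_rel_scale[of u 0 c] by (simp add: zero_fun_def)
next
  case (left x u)
  then show ?case using lie_rel_mmult[OF lie_rel_refl[of x], of u 0]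
    by (simp add: mag_alg_subset_hat zero_fun_def[symmetric])
next
  case (right x u)
  then show ?case using lie_rel_mmult[OF _ lie_rel_refl[of x], of u 0]
    by (simp add: mag_alg_subset_hat zero_fun_def[symmetric])
next
  case (alt x)
  then show ?case using lie_rel_alt[of x] by (simp add: mag_alg_subset_hat zero_fun_def)
next
  case (jacobi x y z)
  then show ?case using lie_rel_jacobi[of x y z]
    by (simp add: mag_alg_subset_hat zero_fun_def plus_fun_def)
qed

lemma abs_fl_eq_iff: "f \<in> mag_alg_hat \<Longrightarrow> g \<in> mag_alg_hat \<Longrightarrow> abs_fl f = abs_fl g \<longleftrightarrow> lie_rel f g"
  using Quotient3_rel[OF Quotient3_fl, of f g] by (simp add: lie_rel_refl)

lemma fl_cases:
  obtains f where "f \<in> mag_alg_hat" "x = abs_fl f"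
proof
  show "rep_fl x \<in> mag_alg_hat"
    using Quotient3_rep_reflp[OF Quotient3_fl, of x] by (simp add: lie_rel_def)
  show "x = abs_fl (rep_fl x)"
    using Quotient3_abs_rep[OF Quotient3_fl, of x] by simp
qed

lemma abs_fl_simps:
  "0 = abs_fl 0"
  "f \<in> mag_alg_hat \<Longrightarrow> g \<in> mag_alg_hat \<Longrightarrow> abs_fl f + abs_fl g = abs_fl (f + g)"
  "f \<in> mag_alg_hat \<Longrightarrow> g \<in> mag_alg_hat \<Longrightarrow> fl_br (abs_fl f) (abs_fl g) = abs_fl (mmult f g)"
  "f \<in> mag_alg_hat \<Longrightarrow> fl_scale c (abs_fl f) = abs_fl (\<lambda>T. c * f T)"
  "f \<in> mag_alg_hat \<Longrightarrow> fl_comp d (abs_fl f) = abs_fl (hcomp d f)"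
  by (simp_all add: zero_fl_def plus_fl.abs_eq fl_br.abs_eq fl_scale.abs_eq fl_comp.abs_eq lie_rel_refl)

interpretation fl: vector_space fl_scale
proof
  fix c d :: rat and x y :: "'a fl"
  show "fl_scale c (x + y) = fl_scale c x + fl_scale c y"
    by transfer (auto simp: lie_rel_def distrib_left plus_fun_def hcomp_def fun_diff_def zero_fun_def[symmetric]
        intro: lie_ideal_zero intro!: mag_alg_hat_closed(2)[unfolded plus_fun_def] mag_alg_hat_closed)
  show "fl_scale (c + d) x = fl_scale c x + fl_scale d x"
    by transfer (auto simp: lie_rel_def distrib_right plus_fun_def hcomp_def fun_diff_def zero_fun_def[symmetric]
        intro: lie_ideal_zero intro!: mag_alg_hat_closed(2)[unfolded plus_fun_def] mag_alg_hat_closed)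
  show "fl_scale c (fl_scale d x) = fl_scale (c * d) x"
    by transfer (auto simp: mult.assoc intro!: lie_rel_refl mag_alg_hat_closed simp: lie_rel_def)
  show "fl_scale 1 x = x"
    by transfer simp
qed

lemma fl_br_add_left: "fl_br (x + y) z = fl_br x z + fl_br y z"
  and fl_br_add_right: "fl_br z (x + y) = fl_br z x + fl_br z y"
  and fl_br_scale_left: "fl_br (fl_scale c x) z = fl_scale c (fl_br x z)"
  and fl_br_scale_right: "fl_br z (fl_scale c x) = fl_scale c (fl_br z x)"
proof -
  obtain f where f: "f \<in> mag_alg_hat" "x = abs_fl f" by (rule fl_cases)
  obtain g where g: "g \<in> mag_alg_hat" "y = abs_fl g" by (rule fl_cases)
  obtain h where h: "h \<in> mag_alg_hat" "z = abs_fl h" by (rule fl_cases)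
  note [simp] = abs_fl_simps mag_alg_hat_closed mag_alg_hat_mmult
    mmult_add_left mmult_add_right mmult_scale_left mmult_scale_right
  show "fl_br (x + y) z = fl_br x z + fl_br y z" "fl_br z (x + y) = fl_br z x + fl_br z y"
    "fl_br (fl_scale c x) z = fl_scale c (fl_br x z)"
    "fl_br z (fl_scale c x) = fl_scale c (fl_br z x)"
    using f g h by simp_all
qed

lemma fl_br_self [simp]: "fl_br x x = 0"
proof -
  obtain f where f: "f \<in> mag_alg_hat" "x = abs_fl f" by (rule fl_cases)
  then show ?thesis
    by (simp add: abs_fl_simps abs_fl_eq_iff lie_rel_alt mag_alg_hat_mmult mag_alg_hat_closed)
qed

lemma fl_br_swap: "fl_br x y = - fl_br y x"
proof -
  have "fl_br (x + y) (x + y) = 0" by (rule fl_br_self)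
  then have "fl_br x y + fl_br y x = 0"
    unfolding fl_br_add_left fl_br_add_right by (simp add: add.commute)
  then show ?thesis by (simp add: eq_neg_iff_add_eq_0)
qed

lemma fl_jacobi: "fl_br x (fl_br y z) + fl_br y (fl_br z x) + fl_br z (fl_br x y) = 0"
proof -
  obtain f where f: "f \<in> mag_alg_hat" "x = abs_fl f" by (rule fl_cases)
  obtain g where g: "g \<in> mag_alg_hat" "y = abs_fl g" by (rule fl_cases)
  obtain h where h: "h \<in> mag_alg_hat" "z = abs_fl h" by (rule fl_cases)
  show ?thesis
    using f g h
    by (simp add: abs_fl_simps mag_alg_hat_mmult mag_alg_hat_closed abs_fl_eq_iff lie_rel_jacobi)
qed

interpretation fl_br_left: additive "\<lambda>x. fl_br x y"
  by standard (rule fl_br_add_left)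

interpretation fl_br_right: additive "fl_br x"
  by standard (rule fl_br_add_right)

lemma fl_br_leibniz: "fl_br x (fl_br y z) = fl_br (fl_br x y) z + fl_br y (fl_br x z)"
proof -
  have "fl_br x (fl_br y z) = - fl_br y (fl_br z x) - fl_br z (fl_br x y)"
    using fl_jacobi[of x y z] by (simp add: algebra_simps eq_neg_iff_add_eq_0)
  also have "\<dots> = fl_br y (fl_br x z) + fl_br (fl_br x y) z"
    using fl_br_swap[of z x] fl_br_swap[of z "fl_br x y"] by (simp add: fl_br_right.minus)
  finally show ?thesis by (simp add: add.commute)
qed

interpretation fl_comp: additive "fl_comp d"
proof
  fix x y :: "'a fl"
  show "fl_comp d (x + y) = fl_comp d x + fl_comp d y"
    by transfer (auto simp: hcomp_simps intro!: lie_rel_refl mag_alg_hat_closed simp: lie_rel_def)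
qed

lemma fl_comp_scale: "fl_comp d (fl_scale c x) = fl_scale c (fl_comp d x)"
  by transfer (auto simp: hcomp_simps intro!: lie_rel_refl mag_alg_hat_closed simp: lie_rel_def)

text \<open>The degree filtration is separated because \<open>lie_rel\<close> tests every
  homogeneous component on its own.\<close>

lemma fl_eqI:
  assumes "\<And>d. fl_comp d x = fl_comp d y"
  shows "x = y"
proof -
  obtain f where f: "f \<in> mag_alg_hat" "x - y = abs_fl f" by (rule fl_cases)
  have "fl_comp d (x - y) = 0" for d
    using assms by (simp add: fl_comp.diff)
  then have "lie_rel (hcomp d f) 0" for d
    using f by (simp add: abs_fl_simps abs_fl_eq_iff mag_alg_hat_closed)
  then have "hcomp d (hcomp d f) \<in> lie_ideal" for d
    by (simp add: lie_rel_zero_iff)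
  then have "lie_rel f 0"
    using f by (simp add: lie_rel_zero_iff hcomp_hcomp)
  then have "x - y = 0"
    using f by (simp add: abs_fl_simps abs_fl_eq_iff mag_alg_hat_closed)
  then show ?thesis by simp
qed

section \<open>Derivations of the free Lie algebra\<close>

text \<open>
  The derivation of the magma algebra with \<open>Gen a \<mapsto> Gen a \<cdot> m a\<close>, computed coefficientwise: the
  coefficient at \<open>U\<close> sums, over the subtrees \<open>Br (Gen a) V\<close> of \<open>U\<close>, the contributions of the
  monomials obtained by contracting that subtree to \<open>Gen a\<close>. No finiteness is needed in this form.
\<close>

primrec mag_der_at :: "('a \<Rightarrow> 'a lmon \<Rightarrow> rat) \<Rightarrow> 'a lmon \<Rightarrow> ('a lmon \<Rightarrow> rat) \<Rightarrow> rat" where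
  "mag_der_at m (Gen a) f = 0"
| "mag_der_at m (Br l r) f = (case l of Gen a \<Rightarrow> f (Gen a) * m a r | Br _ _ \<Rightarrow> 0) +
     mag_der_at m l (\<lambda>T. f (Br T r)) + mag_der_at m r (\<lambda>T. f (Br l T))"

definition mag_der :: "('a \<Rightarrow> 'a lmon \<Rightarrow> rat) \<Rightarrow> ('a lmon \<Rightarrow> rat) \<Rightarrow> 'a lmon \<Rightarrow> rat" where
  "mag_der m f U = mag_der_at m U f"

lemma mag_der_at_add: "mag_der_at m U (\<lambda>T. f T + g T) = mag_der_at m U f + mag_der_at m U g"
  by (induction U arbitrary: f g) (auto simp: algebra_simps split: lmon.splits)

lemma mag_der_at_scale: "mag_der_at m U (\<lambda>T. c * f T) = c * mag_der_at m U f"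
  by (induction U arbitrary: f) (auto simp: algebra_simps split: lmon.splits)

lemma mag_der_at_zero [simp]: "mag_der_at m U (\<lambda>T. 0) = 0"
  using mag_der_at_scale[of m U 0] by simp

text \<open>Contracting \<open>Br (Gen a) V\<close> to \<open>Gen a\<close> lowers the degree, so a
  coefficient at \<open>U\<close> reads only strictly lower degrees. Both the truncation arguments
  and the gain of one in order rest on this.\<close>

lemma mag_der_at_cong_deg:
  assumes "\<And>T. deg T < deg U \<Longrightarrow> f T = g T"
  shows "mag_der_at m U f = mag_der_at m U g"
  using assms
proof (induction U arbitrary: f g)
  case (Br l r)
  have "f (Gen a) = g (Gen a)" if "l = Gen a" for a
    using Br.prems[of "Gen a"] that by (simp add: neq0_conv[symmetric])
  moreover have "mag_der_at m l (\<lambda>T. f (Br T r)) = mag_der_at m l (\<lambda>T. g (Br T r))"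
    by (rule Br.IH) (auto intro!: Br.prems)
  moreover have "mag_der_at m r (\<lambda>T. f (Br l T)) = mag_der_at m r (\<lambda>T. g (Br l T))"
    by (rule Br.IH) (auto intro!: Br.prems)
  ultimately show ?case by (simp split: lmon.splits)
qed simp

text \<open>A generator of \<open>U\<close> outside \<open>S\<close> either survives the
  contraction, where \<open>f\<close> vanishes, or lies in the contracted \<open>V\<close>, where
  \<open>m a\<close> vanishes if \<open>a\<close> is in \<open>S\<close>; if \<open>a\<close> is not
  in \<open>S\<close>, it survives itself.\<close>

lemma mag_der_at_eq_0_support:
  assumes "\<And>a V. a \<in> S \<Longrightarrow> \<not> gens V \<subseteq> S \<Longrightarrow> m a V = 0"
    and "\<And>T. \<not> gens T \<subseteq> S \<Longrightarrow> f T = 0" and "\<not> gens U \<subseteq> S"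
  shows "mag_der_at m U f = 0"
  using assms(2,3)
proof (induction U arbitrary: f)
  case (Br l r)
  have 1: "f (Gen a) * m a r = 0" if "l = Gen a" for a
    using Br.prems(1)[of "Gen a"] Br.prems(2) assms(1)[of a r] that by auto
  have 2: "mag_der_at m l (\<lambda>T. f (Br T r)) = 0"
  proof (cases "gens r \<subseteq> S")
    case True
    then show ?thesis using Br.prems by (intro Br.IH) auto
  next
    case False
    then have "(\<lambda>T. f (Br T r)) = (\<lambda>T. 0)"
      using Br.prems(1) by (auto simp: fun_eq_iff)
    then show ?thesis by simp
  qed
  have 3: "mag_der_at m r (\<lambda>T. f (Br l T)) = 0"
  proof (cases "gens l \<subseteq> S")
    case True
    then show ?thesis using Br.prems by (intro Br.IH) auto
  next
    case False
    then have "(\<lambda>T. f (Br l T)) = (\<lambda>T. 0)"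
      using Br.prems(1) by (auto simp: fun_eq_iff)
    then show ?thesis by simp
  qed
  show ?case using 1 2 3 by (auto split: lmon.splits)
qed simp

lemma mag_der_add: "mag_der m (f + g) = mag_der m f + mag_der m g"
  by (simp add: fun_eq_iff mag_der_def plus_fun_def mag_der_at_add)

lemma mag_der_scale: "mag_der m (\<lambda>T. c * f T) = (\<lambda>T. c * mag_der m f T)"
  by (simp add: fun_eq_iff mag_der_def mag_der_at_scale)

interpretation mag_der: additive "mag_der m"
  by standard (rule mag_der_add)

lemma mag_der_mmult: "mag_der m (mmult f g) = mmult (mag_der m f) g + mmult f (mag_der m g)"
proof
  fix U
  show "mag_der m (mmult f g) U = (mmult (mag_der m f) g + mmult f (mag_der m g)) U"
  proof (cases U)
    case (Br l r)
    have "mag_der_at m l (\<lambda>T. f T * g r) = mag_der_at m l f * g r"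
      using mag_der_at_scale[of m l "g r" f] by (simp add: mult.commute[of "g r"])
    then show ?thesis
      by (simp add: Br mag_der_def mag_der_at_scale split: lmon.splits)
  qed (simp add: mag_der_def)
qed

definition mag_mono :: "'a lmon \<Rightarrow> 'a lmon \<Rightarrow> rat" where
  "mag_mono T = (\<lambda>U. if U = T then 1 else 0)"

lemma mag_mono_Br: "mag_mono (Br l r) = mmult (mag_mono l) (mag_mono r)"
  by (auto simp: fun_eq_iff mag_mono_def mmult_def split: lmon.splits)

lemma mag_mono_mag_alg: "mag_mono T \<in> mag_alg"
  by (auto simp: mag_alg_def mag_mono_def)

lemma mag_der_Gen: "mag_der m (mag_mono (Gen a)) = mmult (mag_mono (Gen a)) (m a)"
proof
  fix U
  show "mag_der m (mag_mono (Gen a)) U = mmult (mag_mono (Gen a)) (m a) U"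
    by (cases U) (auto simp: mag_der_def mag_mono_def split: lmon.splits)
qed

lemma mag_alg_expand:
  assumes "f \<in> mag_alg"
  shows "f = (\<Sum>T | f T \<noteq> 0. (\<lambda>U. f T * mag_mono T U))"
proof
  fix U
  have fin: "finite {T. f T \<noteq> 0}" using assms by (simp add: mag_alg_def)
  have "(\<Sum>T | f T \<noteq> 0. (\<lambda>U. f T * mag_mono T U)) U = (\<Sum>T | f T \<noteq> 0. if T = U then f T else 0)"
    unfolding sum_fun_apply by (rule sum.cong) (auto simp: mag_mono_def)
  also have "\<dots> = f U" using fin by simp
  finally show "f U = (\<Sum>T | f T \<noteq> 0. (\<lambda>U. f T * mag_mono T U)) U" by simp
qed

lemma mag_alg_hat_sum: "(\<And>i. i \<in> I \<Longrightarrow> f i \<in> mag_alg_hat) \<Longrightarrow> sum f I \<in> mag_alg_hat"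
  by (induction I rule: infinite_finite_induct) (auto intro: mag_alg_hat_closed)

text \<open>Truncation turns a completed series into a finitely supported element, the only kind
  that \<open>mag_alg\<close> and \<open>lie_ideal\<close> contain.\<close>

definition low_part :: "nat \<Rightarrow> ('a lmon \<Rightarrow> rat) \<Rightarrow> 'a lmon \<Rightarrow> rat" where
  "low_part n f = (\<lambda>T. if deg T < n then f T else 0)"

lemma low_part_eq_sum: "low_part n f = (\<Sum>i<n. hcomp i f)"
  by (simp add: fun_eq_iff sum_fun_apply low_part_def hcomp_def)

lemma low_part_mag_alg: "f \<in> mag_alg_hat \<Longrightarrow> low_part n f \<in> mag_alg"
  unfolding low_part_eq_sum by (intro mag_alg_sum hcomp_mag_alg)

lemma hcomp_mag_der_low_part: "hcomp n (mag_der m (low_part n f)) = hcomp n (mag_der m f)"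
  by (auto simp: fun_eq_iff hcomp_def mag_der_def low_part_def intro!: mag_der_at_cong_deg)

section \<open>Compatibility of the derivation with completion and Lie relations\<close>

context
  fixes m :: "'a \<Rightarrow> 'a lmon \<Rightarrow> rat"
  assumes m: "\<And>a. m a \<in> mag_alg_hat"
begin

lemma mag_der_mono_hat: "mag_der m (mag_mono T) \<in> mag_alg_hat"
proof (induction T)
  case (Gen a)
  show ?case
    unfolding mag_der_Gen by (intro mag_alg_hat_mmult m mag_alg_subset_hat mag_mono_mag_alg)
next
  case (Br l r)
  then show ?case
    unfolding mag_mono_Br mag_der_mmult
    by (intro mag_alg_hat_mmult mag_alg_hat_closed(2)) (simp_all add: mag_alg_subset_hat mag_mono_mag_alg)
qed

lemma mag_der_fin_hat:
  assumes "f \<in> mag_alg"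
  shows "mag_der m f \<in> mag_alg_hat"
proof -
  have "mag_der m f = mag_der m (\<Sum>T | f T \<noteq> 0. (\<lambda>U. f T * mag_mono T U))"
    using mag_alg_expand[OF assms] by simp
  also have "\<dots> \<in> mag_alg_hat"
    unfolding mag_der.sum mag_der_scale
    by (intro mag_alg_hat_sum mag_alg_hat_closed mag_der_mono_hat)
  finally show ?thesis .
qed

lemma mag_der_hat:
  assumes "f \<in> mag_alg_hat"
  shows "mag_der m f \<in> mag_alg_hat"
proof -
  have "hcomp n (mag_der m f) \<in> mag_alg" for n
    using mag_der_fin_hat[OF low_part_mag_alg[OF assms, of n]] hcomp_mag_der_low_part[of n m f]
      hcomp_mag_alg by metis
  then show ?thesis by (simp add: mag_alg_hat_def)
qed

text \<open>The conclusion is \<open>lie_rel\<close> to 0, not membership in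
  \<open>lie_ideal\<close>: the \<open>m a\<close> may be infinite series, so the image of a finite
  element need not be finite. Deriving a generating relation gives antisymmetry or a sum of three
  Jacobi expressions, with one entry derived in each.\<close>

lemma mag_der_lie_ideal: "u \<in> lie_ideal \<Longrightarrow> lie_rel (mag_der m u) 0"
proof (induction rule: lie_ideal.induct)
  case (alt x)
  then have "x \<in> mag_alg_hat" "mag_der m x \<in> mag_alg_hat"
    by (auto intro: mag_alg_subset_hat mag_der_hat)
  then have "abs_fl (mag_der m (mmult x x)) = fl_br (abs_fl (mag_der m x)) (abs_fl x) +
      fl_br (abs_fl x) (abs_fl (mag_der m x))"
    by (simp add: mag_der_mmult abs_fl_simps mag_alg_hat_mmult)
  also have "\<dots> = abs_fl 0"
    by (subst fl_br_swap) (simp add: abs_fl_simps(1))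
  finally show ?case
    using \<open>x \<in> mag_alg_hat\<close>
    by (subst (asm) abs_fl_eq_iff)
       (auto intro!: mag_der_hat mag_alg_hat_mmult mag_alg_hat_closed simp: zero_fun_def[symmetric])
next
  case (jacobi x y z)
  then have *: "x \<in> mag_alg_hat" "mag_der m x \<in> mag_alg_hat" "y \<in> mag_alg_hat"
    "mag_der m y \<in> mag_alg_hat" "z \<in> mag_alg_hat" "mag_der m z \<in> mag_alg_hat"
    by (auto intro: mag_alg_subset_hat mag_der_hat)
  let ?J = "\<lambda>x y z. mmult x (mmult y z) + mmult y (mmult z x) + mmult z (mmult x y)"
  have "mag_der m (?J x y z) = ?J (mag_der m x) y z + ?J x (mag_der m y) z + ?J x y (mag_der m z)"
    by (simp add: mag_der_add mag_der_mmult mmult_add_left mmult_add_right algebra_simps)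
  moreover have "lie_rel (?J (mag_der m x) y z + ?J x (mag_der m y) z + ?J x y (mag_der m z)) (0 + 0 + 0)"
    using * by (intro lie_rel_add[OF lie_rel_add] lie_rel_jacobi)
  ultimately show ?case by (simp add: zero_fun_def plus_fun_def)
next
  case (add u v)
  then show ?case using lie_rel_add[of "mag_der m u" 0 "mag_der m v" 0]
    by (simp add: mag_der_add[unfolded plus_fun_def] zero_fun_def plus_fun_def)
next
  case (scale u c)
  then show ?case using lie_rel_scale[of "mag_der m u" 0 c]
    by (simp add: mag_der_scale zero_fun_def)
next
  case (left x u)
  have "x \<in> mag_alg_hat" using left by (simp add: mag_alg_subset_hat)
  then have "lie_rel (mag_der m x) (mag_der m x)" "lie_rel x x"
    by (auto intro!: lie_rel_refl mag_der_hat)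
  moreover have "lie_rel u 0" by (rule lie_ideal_imp_lie_rel) fact
  moreover have "lie_rel (mag_der m u) 0" using left by (simp add: zero_fun_def)
  ultimately have "lie_rel (mmult (mag_der m x) u + mmult x (mag_der m u))
      (mmult (mag_der m x) 0 + mmult x 0)"
    by (intro lie_rel_add lie_rel_mmult)
  then have "lie_rel (mmult (mag_der m x) u + mmult x (mag_der m u)) 0" by simp
  then show ?case by (simp add: mag_der_mmult plus_fun_def zero_fun_def)
next
  case (right x u)
  have "x \<in> mag_alg_hat" using right by (simp add: mag_alg_subset_hat)
  then have "lie_rel (mag_der m x) (mag_der m x)" "lie_rel x x"
    by (auto intro!: lie_rel_refl mag_der_hat)
  moreover have "lie_rel u 0" by (rule lie_ideal_imp_lie_rel) fact
  moreover have "lie_rel (mag_der m u) 0" using right by (simp add: zero_fun_def)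
  ultimately have "lie_rel (mmult (mag_der m u) x + mmult u (mag_der m x))
      (mmult 0 x + mmult 0 (mag_der m x))"
    by (intro lie_rel_add lie_rel_mmult)
  then have "lie_rel (mmult (mag_der m u) x + mmult u (mag_der m x)) 0" by simp
  then show ?case by (simp add: mag_der_mmult plus_fun_def zero_fun_def)
qed

lemma mag_der_lie_rel:
  assumes "lie_rel f g"
  shows "lie_rel (mag_der m f) (mag_der m g)"
proof -
  have fg: "f \<in> mag_alg_hat" "g \<in> mag_alg_hat" "\<And>d. hcomp d (f - g) \<in> lie_ideal"
    using assms by (auto simp: lie_rel_def)
  have "hcomp n (mag_der m (f - g)) \<in> lie_ideal" for n
  proof -
    have "low_part n (f - g) \<in> lie_ideal"
      unfolding low_part_eq_sum by (intro lie_ideal_sum fg)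
    then show ?thesis
      using mag_der_lie_ideal hcomp_mag_der_low_part[of n m "f - g"] lie_rel_zero_iff by metis
  qed
  then show ?thesis
    using fg by (auto simp: lie_rel_def mag_der.diff intro: mag_der_hat)
qed

end

text \<open>Defined through a chosen representative because independence of that choice holds under
  the hypothesis that every \<open>m a\<close> lies in \<open>mag_alg_hat\<close>;
  \<open>fl_der_abs\<close> supplies it.\<close>

definition fl_der :: "('a \<Rightarrow> 'a lmon \<Rightarrow> rat) \<Rightarrow> 'a fl \<Rightarrow> 'a fl" where
  "fl_der m x = abs_fl (mag_der m (rep_fl x))"

lemma fl_der_abs:
  assumes "\<And>a. m a \<in> mag_alg_hat" "f \<in> mag_alg_hat"
  shows "fl_der m (abs_fl f) = abs_fl (mag_der m f)"
proof -
  have "lie_rel (rep_fl (abs_fl f)) f"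
    by (rule rep_abs_rsp_left[OF Quotient3_fl]) (rule lie_rel_refl[OF assms(2)])
  then have "lie_rel (mag_der m (rep_fl (abs_fl f))) (mag_der m f)"
    by (rule mag_der_lie_rel[OF assms(1)])
  then show ?thesis
    using Quotient3_rel_abs[OF Quotient3_fl] by (simp add: fl_der_def)
qed

definition fl_mono :: "'a lmon \<Rightarrow> 'a fl" where
  "fl_mono T = abs_fl (mag_mono T)"

lemma fl_mono_Gen: "fl_mono (Gen a) = fl_gen a"
  by (simp add: fl_mono_def mag_mono_def fl_gen_def)

lemma fl_mono_Br: "fl_mono (Br l r) = fl_br (fl_mono l) (fl_mono r)"
  by (simp add: fl_mono_def mag_mono_Br abs_fl_simps mag_alg_subset_hat mag_mono_mag_alg)

text \<open>The laws hold on the whole type, which spares the membership conditions of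
  \<open>is_cont_derivation\<close>; these return only when \<open>D\<close> is restricted to
  \<open>FL S\<close>.\<close>

locale fl_derivation =
  fixes D :: "'a fl \<Rightarrow> 'a fl"
  assumes add: "D (x + y) = D x + D y"
    and scale: "D (fl_scale c x) = fl_scale c (D x)"
    and br: "D (fl_br x y) = fl_br (D x) y + fl_br x (D y)"
begin

sublocale additive D
  by standard (rule add)

end

section \<open>The degree filtration\<close>

definition fl_ord_ge :: "nat \<Rightarrow> 'a fl \<Rightarrow> bool" where
  "fl_ord_ge n x \<longleftrightarrow> (\<forall>i<n. fl_comp i x = 0)"

text \<open>The low part of any representative is a finite sum of components in the ideal, so
  subtracting it does not change the class.\<close>

lemma fl_ord_geE:
  assumes "fl_ord_ge n x"
  obtains f where "f \<in> mag_alg_hat" "x = abs_fl f" "\<And>T. deg T < n \<Longrightarrow> f T = 0"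
proof -
  obtain f where f: "f \<in> mag_alg_hat" "x = abs_fl f" by (rule fl_cases)
  have l: "low_part n f \<in> mag_alg_hat"
    using f by (simp add: mag_alg_subset_hat low_part_mag_alg)
  have "lie_rel (hcomp i f) 0" if "i < n" for i
    using assms f that by (simp add: fl_ord_ge_def abs_fl_simps abs_fl_eq_iff mag_alg_hat_closed)
  then have "hcomp i (hcomp i f) \<in> lie_ideal" if "i < n" for i
    using that by (auto simp: lie_rel_zero_iff)
  then have "low_part n f \<in> lie_ideal"
    unfolding low_part_eq_sum by (intro lie_ideal_sum) (simp add: hcomp_hcomp)
  then have "lie_rel (low_part n f) 0" by (rule lie_ideal_imp_lie_rel)
  then have "lie_rel (f - low_part n f) f"
    using f l by (auto simp: lie_rel_def hcomp_simps intro: mag_alg_hat_closed lie_ideal_uminus)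
  then have "x = abs_fl (f - low_part n f)"
    using f(2) abs_fl_eq_iff[OF mag_alg_hat_closed(3)[OF f(1) l] f(1)] by metis
  then show ?thesis
    using f l by (intro that[of "f - low_part n f"]) (auto simp: low_part_def intro: mag_alg_hat_closed)
qed

lemma fl_ord_ge_abs:
  assumes "f \<in> mag_alg_hat" "\<And>T. deg T < n \<Longrightarrow> f T = 0"
  shows "fl_ord_ge n (abs_fl f)"
proof -
  have "hcomp i f = 0" if "i < n" for i
    using assms that by (auto simp: hcomp_def fun_eq_iff)
  then show ?thesis
    using assms by (simp add: fl_ord_ge_def abs_fl_simps)
qed

text \<open>The left factor of a tree has degree at least one, whatever \<open>x\<close> is. Hence
  powers of ad tend to zero in the degree topology.\<close>

lemma fl_ord_ge_br:
  assumes "fl_ord_ge n y"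
  shows "fl_ord_ge (Suc n) (fl_br x y)"
proof -
  obtain f where f: "f \<in> mag_alg_hat" "x = abs_fl f" by (rule fl_cases)
  obtain g where g: "g \<in> mag_alg_hat" "y = abs_fl g" "\<And>T. deg T < n \<Longrightarrow> g T = 0"
    using assms by (rule fl_ord_geE) blast
  have "mmult f g T = 0" if T: "deg T < Suc n" for T
  proof (cases T)
    case (Br l r)
    have "deg l \<noteq> 0" by simp
    then have "deg r < n" using T unfolding Br by (simp del: deg_neq_0)
    then show ?thesis using g by (simp add: Br)
  qed simp
  then have "fl_ord_ge (Suc n) (abs_fl (mmult f g))"
    using f g by (intro fl_ord_ge_abs mag_alg_hat_mmult)
  then show ?thesis using f g by (simp add: abs_fl_simps)
qed

lemma fl_ord_ge_add: "fl_ord_ge n x \<Longrightarrow> fl_ord_ge n y \<Longrightarrow> fl_ord_ge n (x + y)"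
  by (simp add: fl_ord_ge_def fl_comp.add)

lemma fl_ord_ge_sum: "(\<And>i. i \<in> I \<Longrightarrow> fl_ord_ge n (f i)) \<Longrightarrow> fl_ord_ge n (sum f I)"
  by (simp add: fl_ord_ge_def fl_comp.sum)

lemma fl_ord_ge_scale: "fl_ord_ge n x \<Longrightarrow> fl_ord_ge n (fl_scale c x)"
  by (simp add: fl_ord_ge_def fl_comp_scale)

lemma fl_ord_ge_mono: "fl_ord_ge n x \<Longrightarrow> k \<le> n \<Longrightarrow> fl_ord_ge k x"
  by (simp add: fl_ord_ge_def)

lemma fl_eqI_ord: "(\<And>n. fl_ord_ge n (x - y)) \<Longrightarrow> x = y"
  by (rule fl_eqI) (metis fl_ord_ge_def lessI fl_comp.diff eq_iff_diff_eq_0)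

section \<open>The subalgebra over S and its stability under the derivation\<close>

lemma FL_iff: "x \<in> FL S \<longleftrightarrow> (\<exists>f. x = abs_fl f \<and> f \<in> mag_alg_hat \<and> (\<forall>T. f T \<noteq> 0 \<longrightarrow> gens T \<subseteq> S))"
  by (auto simp: FL_def)

lemma FL_add:
  assumes "x \<in> FL S" "y \<in> FL S"
  shows "x + y \<in> FL S"
proof -
  obtain f g where "x = abs_fl f" "f \<in> mag_alg_hat" "\<forall>T. f T \<noteq> 0 \<longrightarrow> gens T \<subseteq> S"
    "y = abs_fl g" "g \<in> mag_alg_hat" "\<forall>T. g T \<noteq> 0 \<longrightarrow> gens T \<subseteq> S"
    using assms by (auto simp: FL_iff)
  then show ?thesis unfolding FL_iff
    by (intro exI[of _ "f + g"] conjI allI impI)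
       (auto simp: abs_fl_simps intro: mag_alg_hat_closed, metis add_0 subsetD)
qed

lemma FL_br:
  assumes "x \<in> FL S" "y \<in> FL S"
  shows "fl_br x y \<in> FL S"
proof -
  obtain f g where "x = abs_fl f" "f \<in> mag_alg_hat" "\<forall>T. f T \<noteq> 0 \<longrightarrow> gens T \<subseteq> S"
    "y = abs_fl g" "g \<in> mag_alg_hat" "\<forall>T. g T \<noteq> 0 \<longrightarrow> gens T \<subseteq> S"
    using assms by (auto simp: FL_iff)
  then show ?thesis unfolding FL_iff
    by (intro exI[of _ "mmult f g"])
       (auto simp: abs_fl_simps mmult_def split: lmon.splits intro: mag_alg_hat_mmult)
qed

lemma FL_scale:
  assumes "x \<in> FL S"
  shows "fl_scale c x \<in> FL S"
proof -
  obtain f where "x = abs_fl f" "f \<in> mag_alg_hat" "\<forall>T. f T \<noteq> 0 \<longrightarrow> gens T \<subseteq> S"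
    using assms by (auto simp: FL_iff)
  then show ?thesis unfolding FL_iff
    by (intro exI[of _ "\<lambda>T. c * f T"]) (auto simp: abs_fl_simps intro: mag_alg_hat_closed)
qed

lemma FL_zero: "0 \<in> FL S"
  unfolding FL_iff by (intro exI[of _ 0]) (auto simp: abs_fl_simps intro: mag_alg_hat_closed)

lemma FL_sum: "(\<And>i. i \<in> I \<Longrightarrow> f i \<in> FL S) \<Longrightarrow> sum f I \<in> FL S"
  by (induction I rule: infinite_finite_induct) (auto intro: FL_zero FL_add)

lemma FL_uminus: "x \<in> FL S \<Longrightarrow> - x \<in> FL S"
  using FL_scale[of x S "-1"] by (simp add: fl.scale_minus_left)

lemma FL_diff: "x \<in> FL S \<Longrightarrow> y \<in> FL S \<Longrightarrow> x - y \<in> FL S"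
  using FL_add[of x S "- y"] FL_uminus[of y S] by simp

lemma FL_mono: "gens T \<subseteq> S \<Longrightarrow> fl_mono T \<in> FL S"
  unfolding FL_iff fl_mono_def
  by (intro exI[of _ "mag_mono T"])
     (auto simp: mag_mono_def[of T] mag_alg_subset_hat[OF mag_mono_mag_alg[of T, unfolded mag_mono_def]])

lemma FL_gen: "a \<in> S \<Longrightarrow> fl_gen a \<in> FL S"
  using FL_mono[of "Gen a" S] by (simp add: fl_mono_Gen)

context
  fixes m :: "'a \<Rightarrow> 'a lmon \<Rightarrow> rat"
  assumes m: "\<And>a. m a \<in> mag_alg_hat"
begin

lemma fl_der_derivation: "fl_derivation (fl_der m)"
proof
  fix x y :: "'a fl" and c
  obtain f where f: "f \<in> mag_alg_hat" "x = abs_fl f" by (rule fl_cases)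
  obtain g where g: "g \<in> mag_alg_hat" "y = abs_fl g" by (rule fl_cases)
  note [simp] = abs_fl_simps mag_alg_hat_closed mag_alg_hat_mmult fl_der_abs m mag_der_hat
  show "fl_der m (x + y) = fl_der m x + fl_der m y"
    using f g by (simp add: mag_der_add)
  show "fl_der m (fl_scale c x) = fl_scale c (fl_der m x)"
    using f g by (simp add: mag_der_scale)
  show "fl_der m (fl_br x y) = fl_br (fl_der m x) y + fl_br x (fl_der m y)"
    using f g by (simp add: mag_der_mmult)
qed

lemma fl_der_gen: "fl_der m (fl_gen a) = fl_br (fl_gen a) (abs_fl (m a))"
  unfolding fl_mono_Gen[symmetric] fl_mono_def
  by (simp add: fl_der_abs m mag_alg_subset_hat mag_mono_mag_alg mag_der_Gen abs_fl_simps)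

lemma fl_der_ord:
  assumes "fl_ord_ge n x"
  shows "fl_ord_ge (Suc n) (fl_der m x)"
proof -
  obtain f where f: "f \<in> mag_alg_hat" "x = abs_fl f" "\<And>T. deg T < n \<Longrightarrow> f T = 0"
    using assms by (rule fl_ord_geE) blast
  have "mag_der m f U = 0" if "deg U < Suc n" for U
  proof -
    have "mag_der_at m U f = mag_der_at m U (\<lambda>T. 0)"
      using f that by (intro mag_der_at_cong_deg) simp
    then show ?thesis by (simp add: mag_der_def)
  qed
  then show ?thesis
    using f by (auto simp: fl_der_abs m intro!: fl_ord_ge_abs mag_der_hat)
qed

lemma fl_der_FL:
  assumes "\<And>a T. a \<in> S \<Longrightarrow> m a T \<noteq> 0 \<Longrightarrow> gens T \<subseteq> S" "x \<in> FL S"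
  shows "fl_der m x \<in> FL S"
proof -
  obtain f where f: "x = abs_fl f" "f \<in> mag_alg_hat" "\<forall>T. f T \<noteq> 0 \<longrightarrow> gens T \<subseteq> S"
    using assms by (auto simp: FL_iff)
  have "gens U \<subseteq> S" if "mag_der m f U \<noteq> 0" for U
  proof (rule ccontr)
    assume "\<not> gens U \<subseteq> S"
    then have "mag_der_at m U f = 0"
      using f assms(1) by (intro mag_der_at_eq_0_support[of S]) auto
    then show False using that by (simp add: mag_der_def)
  qed
  then show ?thesis
    using f unfolding FL_iff
    by (intro exI[of _ "mag_der m f"]) (auto simp: fl_der_abs m mag_der_hat)
qed

end

definition low_monos :: "'a set \<Rightarrow> nat \<Rightarrow> 'a lmon set" where
  "low_monos S n = {T. gens T \<subseteq> S \<and> deg T < n}"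

text \<open>Finiteness of \<open>S\<close> is used here: a tree of degree at most n is a generator
  or a product of two trees of degree below n.\<close>

lemma finite_low_monos:
  assumes "finite S"
  shows "finite (low_monos S n)"
proof (induction n)
  case (Suc n)
  have "low_monos S (Suc n) \<subseteq> Gen ` S \<union> (\<lambda>(l, r). Br l r) ` (low_monos S n \<times> low_monos S n)"
  proof
    fix T assume T: "T \<in> low_monos S (Suc n)"
    show "T \<in> Gen ` S \<union> (\<lambda>(l, r). Br l r) ` (low_monos S n \<times> low_monos S n)"
    proof (cases T)
      case (Br l r)
      have "deg l > 0" "deg r > 0" by (simp_all only: neq0_conv[symmetric] deg_neq_0) simp_all
      then show ?thesis using T by (auto simp: Br low_monos_def image_iff)
    qed (use T in \<open>auto simp: low_monos_def\<close>)
  qed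
  then show ?case
    by (rule finite_subset) (use assms Suc in auto)
qed (simp add: low_monos_def)

text \<open>The coefficients are those of a representative supported over \<open>S\<close>. They are
  not canonical, since monomials are linearly dependent in the Lie algebra; existence
  suffices.\<close>

lemma FL_expand:
  assumes "finite S" "x \<in> FL S"
  obtains c where "fl_ord_ge n (x - (\<Sum>T\<in>low_monos S n. fl_scale (c T) (fl_mono T)))"
proof -
  obtain f where f: "x = abs_fl f" "f \<in> mag_alg_hat" "\<forall>T. f T \<noteq> 0 \<longrightarrow> gens T \<subseteq> S"
    using assms by (auto simp: FL_iff)
  have sum_abs: "(\<Sum>T\<in>A. fl_scale (f T) (fl_mono T)) = abs_fl (\<Sum>T\<in>A. (\<lambda>U. f T * mag_mono T U))" for A
  proof (induction A rule: infinite_finite_induct)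
    case (insert T A)
    have "(\<lambda>U. f T * mag_mono T U) \<in> mag_alg_hat" for T
      by (intro mag_alg_hat_closed mag_alg_subset_hat mag_mono_mag_alg)
    then show ?case
      unfolding sum.insert[OF insert.hyps] insert.IH
      by (subst abs_fl_simps(2)[symmetric])
         (auto simp: fl_mono_def abs_fl_simps(4) mag_alg_subset_hat mag_mono_mag_alg
           intro: mag_alg_hat_sum)
  qed (simp_all only: sum.infinite sum.empty abs_fl_simps(1) not_False_eq_True)
  have "(\<Sum>T\<in>low_monos S n. (\<lambda>U. f T * mag_mono T U)) = low_part n f"
  proof
    fix U
    have "(\<Sum>T\<in>low_monos S n. (\<lambda>U. f T * mag_mono T U)) U = (\<Sum>T\<in>low_monos S n. if T = U then f T else 0)"
      unfolding sum_fun_apply by (rule sum.cong) (auto simp: mag_mono_def)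
    also have "\<dots> = low_part n f U"
      using finite_low_monos[OF assms(1)] f(3) by (auto simp: low_part_def low_monos_def)
    finally show "(\<Sum>T\<in>low_monos S n. (\<lambda>U. f T * mag_mono T U)) U = low_part n f U" .
  qed
  moreover have "low_part n f \<in> mag_alg_hat"
    using f by (simp add: low_part_mag_alg mag_alg_subset_hat)
  ultimately have "x - (\<Sum>T\<in>low_monos S n. fl_scale (f T) (fl_mono T)) = abs_fl (f - low_part n f)"
    using f by (simp add: sum_abs minus_fl.abs_eq lie_rel_refl)
  moreover have "fl_ord_ge n (abs_fl (f - low_part n f))"
    using f \<open>low_part n f \<in> mag_alg_hat\<close>
    by (intro fl_ord_ge_abs mag_alg_hat_closed) (auto simp: low_part_def)
  ultimately show ?thesis using that by metis
qed

section \<open>Power series in t with coefficients in the free Lie algebra\<close>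

text \<open>Split the factor n + 1 as i + (n + 1 - i) under the sum; each half loses its term with
  factor zero. Keeping \<open>b\<close> a bare double family lets one rule serve brackets, scalars,
  the flow and an auxiliary variable s.\<close>

lemma (in module) convolution_product_rule:
  fixes b :: "nat \<Rightarrow> nat \<Rightarrow> 'b"
  shows "scale (of_nat (Suc n)) (\<Sum>i\<le>Suc n. b i (Suc n - i)) =
    (\<Sum>i\<le>n. scale (of_nat (Suc i)) (b (Suc i) (n - i))) +
    (\<Sum>i\<le>n. scale (of_nat (Suc (n - i))) (b i (Suc (n - i))))"
proof -
  have "scale (of_nat (Suc n)) (\<Sum>i\<le>Suc n. b i (Suc n - i)) =
      (\<Sum>i\<le>Suc n. scale (of_nat i) (b i (Suc n - i)) + scale (of_nat (Suc n - i)) (b i (Suc n - i)))"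
    unfolding scale_sum_right
    by (rule sum.cong) (simp_all add: scale_left_distrib[symmetric] of_nat_add[symmetric] del: of_nat_add of_nat_Suc)
  also have "\<dots> = (\<Sum>i\<le>Suc n. scale (of_nat i) (b i (Suc n - i))) +
      (\<Sum>i\<le>Suc n. scale (of_nat (Suc n - i)) (b i (Suc n - i)))"
    by (rule sum.distrib)
  also have "(\<Sum>i\<le>Suc n. scale (of_nat i) (b i (Suc n - i))) =
      (\<Sum>i\<le>n. scale (of_nat (Suc i)) (b (Suc i) (n - i)))"
    by (simp add: sum.atMost_Suc_shift del: sum.atMost_Suc of_nat_Suc)
  also have "(\<Sum>i\<le>Suc n. scale (of_nat (Suc n - i)) (b i (Suc n - i))) =
      (\<Sum>i\<le>n. scale (of_nat (Suc (n - i))) (b i (Suc (n - i))))"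
    by (simp add: Suc_diff_le del: of_nat_Suc of_nat_diff)
  finally show ?thesis .
qed

lemma flt_br_nth: "fps_nth (flt_br x y) k = (\<Sum>i\<le>k. fl_br (fps_nth x i) (fps_nth y (k - i)))"
  by (simp add: flt_br_def)

lemma flt_scale_nth:
  "fps_nth (flt_scale c x) k = (\<Sum>i\<le>k. fl_scale (fps_nth c i) (fps_nth x (k - i)))"
  by (simp add: flt_scale_def)

lemma flt_comp_nth [simp]: "fps_nth (flt_comp d x) k = fl_comp d (fps_nth x k)"
  by (simp add: flt_comp_def)

lemma flt_ddt_nth [simp]: "fps_nth (flt_ddt x) k = fl_scale (of_nat (Suc k)) (fps_nth x (Suc k))"
  by (simp add: flt_ddt_def)

lemma flt_scale_const_nth [simp]: "fps_nth (flt_scale (fps_const c) x) k = fl_scale c (fps_nth x k)"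
proof -
  have "fps_nth (flt_scale (fps_const c) x) k =
      (\<Sum>i\<le>k. if i = 0 then fl_scale c (fps_nth x k) else 0)"
    unfolding flt_scale_nth by (rule sum.cong) auto
  then show ?thesis by simp
qed

lemma flt_scale_uminus_X_nth:
  "fps_nth (flt_scale (- fps_X) x) k = (case k of 0 \<Rightarrow> 0 | Suc j \<Rightarrow> - fps_nth x j)"
proof -
  have "fps_nth (flt_scale (- fps_X) x) k =
      (\<Sum>i\<le>k. if i = 1 then - fps_nth x (k - 1) else 0)"
    unfolding flt_scale_nth by (rule sum.cong) auto
  then show ?thesis by (cases k) auto
qed

lemma flt_scale_one [simp]: "flt_scale 1 x = x"
  using flt_scale_const_nth[of 1 x] by (simp add: fps_eq_iff)

interpretation flt: vector_space "\<lambda>c. flt_scale (fps_const c)"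
  by standard (simp_all add: fps_eq_iff fl.scale_right_distrib fl.scale_left_distrib)

lemma fps_nth_sum: "fps_nth (\<Sum>i\<in>I. f i :: 'b :: ab_group_add fps) k = (\<Sum>i\<in>I. fps_nth (f i) k)"
  by (induction I rule: infinite_finite_induct) auto

interpretation flt_br_left: additive "\<lambda>x. flt_br x y"
  by standard (simp add: fps_eq_iff flt_br_nth fl_br_add_left sum.distrib)

interpretation flt_br_right: additive "flt_br x"
  by standard (simp add: fps_eq_iff flt_br_nth fl_br_add_right sum.distrib)

interpretation flt_scale: additive "flt_scale c"
  by standard (simp add: fps_eq_iff flt_scale_nth fl.scale_right_distrib sum.distrib)

lemma flt_br_scale_const:
  "flt_br (flt_scale (fps_const c) x) y = flt_scale (fps_const c) (flt_br x y)"
  "flt_br x (flt_scale (fps_const c) y) = flt_scale (fps_const c) (flt_br x y)"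
  by (simp_all add: fps_eq_iff flt_br_nth fl_br_scale_left fl_br_scale_right fl.scale_sum_right)

lemma flt_ddt_scale_const:
  "flt_ddt (flt_scale (fps_const c) x) = flt_scale (fps_const c) (flt_ddt x)"
  by (simp add: fps_eq_iff mult.commute)

lemma flt_br_swap: "flt_br x y = - flt_br y x"
proof (rule fps_ext)
  fix k
  have "(\<Sum>i\<le>k. fl_br (fps_nth x i) (fps_nth y (k - i))) =
      (\<Sum>i\<le>k. fl_br (fps_nth x (k - i)) (fps_nth y i))"
    by (rule sum.reindex_bij_witness[of _ "\<lambda>i. k - i" "\<lambda>i. k - i"]) auto
  also have "\<dots> = (\<Sum>i\<le>k. - fl_br (fps_nth y i) (fps_nth x (k - i)))"
    by (rule sum.cong) (auto intro: fl_br_swap)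
  finally show "fps_nth (flt_br x y) k = fps_nth (- flt_br y x) k"
    by (simp add: flt_br_nth sum_negf)
qed

lemma sum_triangle_swap:
  "(\<Sum>i\<le>k. \<Sum>j\<le>k - i. g i j) = (\<Sum>j\<le>k::nat. \<Sum>i\<le>k - j. g i j :: 'b :: comm_monoid_add)"
  unfolding sum.Sigma[OF finite_atMost ballI[OF finite_atMost]]
  by (rule sum.reindex_bij_witness[of _ "\<lambda>(i, j). (j, i)" "\<lambda>(i, j). (j, i)"]) auto

lemma flt_br_leibniz: "flt_br x (flt_br y z) = flt_br (flt_br x y) z + flt_br y (flt_br x z)"
proof (rule fps_ext)
  fix k
  let ?x = "fps_nth x" and ?y = "fps_nth y" and ?z = "fps_nth z"
  have "fps_nth (flt_br x (flt_br y z)) k =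
      (\<Sum>i\<le>k. \<Sum>j\<le>k - i. fl_br (?x i) (fl_br (?y j) (?z (k - i - j))))"
    by (simp add: flt_br_nth fl_br_right.sum)
  also have "\<dots> = (\<Sum>i\<le>k. \<Sum>j\<le>k - i. fl_br (fl_br (?x i) (?y j)) (?z (k - i - j))) +
      (\<Sum>i\<le>k. \<Sum>j\<le>k - i. fl_br (?y j) (fl_br (?x i) (?z (k - i - j))))"
    by (simp only: fl_br_leibniz[of "?x _" "?y _"] sum.distrib)
  \<comment> \<open>The lemma behind associativity of \<open>fps\<close> multiplication is a pure
    re-indexing of a triangular double sum, so it applies to the nested bracket.\<close>
  also have "(\<Sum>i\<le>k. \<Sum>j\<le>k - i. fl_br (fl_br (?x i) (?y j)) (?z (k - i - j))) =
      (\<Sum>j\<le>k. \<Sum>i\<le>j. fl_br (fl_br (?x i) (?y (j - i))) (?z (k - j)))"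
    by (rule fps_mult_assoc_lemma[of "\<lambda>i j l. fl_br (fl_br (?x i) (?y j)) (?z l)" k k,
          unfolded atLeast0AtMost, symmetric])
  also have "\<dots> = fps_nth (flt_br (flt_br x y) z) k"
    by (simp add: flt_br_nth fl_br_left.sum)
  also have "(\<Sum>i\<le>k. \<Sum>j\<le>k - i. fl_br (?y j) (fl_br (?x i) (?z (k - i - j)))) =
      (\<Sum>j\<le>k. \<Sum>i\<le>k - j. fl_br (?y j) (fl_br (?x i) (?z (k - i - j))))"
    by (rule sum_triangle_swap)
  also have "\<dots> = fps_nth (flt_br y (flt_br x z)) k"
    by (simp add: flt_br_nth fl_br_right.sum add.commute)
  finally show "fps_nth (flt_br x (flt_br y z)) k =
      fps_nth (flt_br (flt_br x y) z + flt_br y (flt_br x z)) k" by simp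
qed

lemma flt_ddt_br: "flt_ddt (flt_br x y) = flt_br (flt_ddt x) y + flt_br x (flt_ddt y)"
proof (rule fps_ext)
  fix k
  show "fps_nth (flt_ddt (flt_br x y)) k = fps_nth (flt_br (flt_ddt x) y + flt_br x (flt_ddt y)) k"
    using fl.convolution_product_rule[of k "\<lambda>i j. fl_br (fps_nth x i) (fps_nth y j)"]
    by (simp add: flt_br_nth fl_br_scale_left fl_br_scale_right del: of_nat_Suc sum.atMost_Suc)
qed

lemma flt_ddt_scale: "flt_ddt (flt_scale c x) = flt_scale (fps_deriv c) x + flt_scale c (flt_ddt x)"
proof (rule fps_ext)
  fix k
  show "fps_nth (flt_ddt (flt_scale c x)) k =
      fps_nth (flt_scale (fps_deriv c) x + flt_scale c (flt_ddt x)) k"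
    using fl.convolution_product_rule[of k "\<lambda>i j. fl_scale (fps_nth c i) (fps_nth x j)"]
    by (simp add: flt_scale_nth mult.commute del: of_nat_Suc sum.atMost_Suc)
qed

lemma flt_ddt_const [simp]: "flt_ddt (fps_const x) = 0"
  by (simp add: fps_eq_iff)

subsection \<open>Sums converging in the t-adic topology\<close>

definition t_ord_ge :: "nat \<Rightarrow> 'b :: zero fps \<Rightarrow> bool" where
  "t_ord_ge n x \<longleftrightarrow> (\<forall>k<n. fps_nth x k = 0)"

text \<open>Cutting the sum at n = k is legitimate when \<open>u n\<close> has t-order at least n,
  as in all uses; otherwise it is just a convention.\<close>

definition t_sum :: "(nat \<Rightarrow> 'b :: comm_monoid_add fps) \<Rightarrow> 'b fps" where
  "t_sum u = Abs_fps (\<lambda>k. \<Sum>n\<le>k. fps_nth (u n) k)"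

lemma t_sum_nth_bound:
  assumes "\<And>n. t_ord_ge n (u n)" "k \<le> N"
  shows "fps_nth (t_sum u) k = (\<Sum>n\<le>N. fps_nth (u n) k)"
proof -
  have "(\<Sum>n\<le>k. fps_nth (u n) k) = (\<Sum>n\<le>N. fps_nth (u n) k)"
    using assms by (intro sum.mono_neutral_left) (auto simp: t_ord_ge_def)
  then show ?thesis by (simp add: t_sum_def)
qed

lemma t_ord_ge_br:
  assumes "t_ord_ge m x" "t_ord_ge n y"
  shows "t_ord_ge (m + n) (flt_br x y)"
  unfolding t_ord_ge_def
proof (intro allI impI)
  fix k assume "k < m + n"
  have "fl_br (fps_nth x i) (fps_nth y (k - i)) = 0" if "i \<le> k" for i
  proof (cases "i < m")
    case False
    then have "k - i < n" using \<open>k < m + n\<close> that by simp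
    then show ?thesis using assms by (simp add: t_ord_ge_def fl_br_right.zero)
  qed (use assms in \<open>simp add: t_ord_ge_def fl_br_left.zero\<close>)
  then show "fps_nth (flt_br x y) k = 0" by (simp add: flt_br_nth)
qed

lemma t_ord_ge_scale_const: "t_ord_ge n x \<Longrightarrow> t_ord_ge n (flt_scale (fps_const c) x)"
  by (simp add: t_ord_ge_def)

lemma t_ord_ge_0 [simp]: "t_ord_ge 0 x"
  by (simp add: t_ord_ge_def)

lemma t_ord_ge_ad_pow:
  assumes "fps_nth G 0 = 0"
  shows "t_ord_ge n ((flt_br G ^^ n) x)"
proof (induction n)
  case (Suc n)
  have "t_ord_ge (Suc 0) G" using assms by (simp add: t_ord_ge_def)
  from t_ord_ge_br[OF this Suc] show ?case by simp
qed simp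

text \<open>The Cauchy product: in the coefficient of t^k both sums may be cut at k, and the pairs
  with i + j > k contribute zero, so the square reduces to the triangle.\<close>

lemma t_sum_br:
  assumes u: "\<And>n. t_ord_ge n (u n)" and v: "\<And>n. t_ord_ge n (v n)"
  shows "flt_br (t_sum u) (t_sum v) = t_sum (\<lambda>n. \<Sum>i\<le>n. flt_br (u i) (v (n - i)))"
proof (rule fps_ext)
  fix k
  have "fps_nth (flt_br (t_sum u) (t_sum v)) k =
      (\<Sum>r\<le>k. fl_br (\<Sum>i\<le>k. fps_nth (u i) r) (\<Sum>j\<le>k. fps_nth (v j) (k - r)))"
    unfolding flt_br_nth
    by (rule sum.cong) (simp_all add: t_sum_nth_bound[of u _ k] t_sum_nth_bound[of v _ k] u v)
  also have "\<dots> = fps_nth (flt_br (\<Sum>i\<le>k. u i) (\<Sum>j\<le>k. v j)) k"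
    by (simp add: flt_br_nth fps_nth_sum)
  also have "\<dots> = (\<Sum>i\<le>k. \<Sum>j\<le>k. fps_nth (flt_br (u i) (v j)) k)"
    by (simp add: flt_br_left.sum flt_br_right.sum fps_nth_sum) (rule sum.swap)
  also have "\<dots> = (\<Sum>(i, j)\<in>{..k} \<times> {..k}. fps_nth (flt_br (u i) (v j)) k)"
    by (rule sum.cartesian_product)
  also have "\<dots> = (\<Sum>(i, j)\<in>{(i, j). i + j \<le> k}. fps_nth (flt_br (u i) (v j)) k)"
    using t_ord_ge_br[OF u v] by (intro sum.mono_neutral_right) (auto simp: t_ord_ge_def, meson not_le)
  also have "\<dots> = (\<Sum>n\<le>k. \<Sum>i\<le>n. fps_nth (flt_br (u i) (v (n - i))) k)"
    by (rule sum.triangle_reindex_eq)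
  also have "\<dots> = fps_nth (t_sum (\<lambda>n. \<Sum>i\<le>n. flt_br (u i) (v (n - i)))) k"
    by (simp add: t_sum_def fps_nth_sum)
  finally show "fps_nth (flt_br (t_sum u) (t_sum v)) k =
      fps_nth (t_sum (\<lambda>n. \<Sum>i\<le>n. flt_br (u i) (v (n - i)))) k" .
qed

section \<open>Operator series and their substitution calculus\<close>

lemma deg_tendsto_unique:
  assumes "deg_tendsto X y" "deg_tendsto X y'"
  shows "y = y'"
proof (rule fps_ext, rule fl_eqI)
  fix k d
  have "\<forall>\<^sub>F N in sequentially. flt_comp d (X N) = flt_comp d y \<and> flt_comp d (X N) = flt_comp d y'"
    using assms by (auto simp: deg_tendsto_def eventually_conj_iff)
  then obtain N where "flt_comp d (X N) = flt_comp d y" "flt_comp d (X N) = flt_comp d y'"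
    using eventually_happens'[OF sequentially_bot] by blast
  then have "flt_comp d y = flt_comp d y'" by simp
  then show "fl_comp d (fps_nth y k) = fl_comp d (fps_nth y' k)"
    by (metis flt_comp_nth)
qed

text \<open>
  The limit in the degree topology is also a \<open>t\<close>-adic one, since the operators in question raise
  the order in \<open>t\<close>; each coefficient of the limit is therefore a finite sum.
\<close>

lemma op_series_eq_t_sum:
  assumes t: "\<And>n. t_ord_ge n ((P ^^ n) x)" and o: "\<And>n k. fl_ord_ge n (fps_nth ((P ^^ n) x) k)"
  shows "op_series c P x = t_sum (\<lambda>n. flt_scale (fps_const (fps_nth c n)) ((P ^^ n) x))"
proof -
  let ?u = "\<lambda>n. flt_scale (fps_const (fps_nth c n)) ((P ^^ n) x)"
  have "flt_comp d (\<Sum>n<N. ?u n) = flt_comp d (t_sum ?u)" if "N \<ge> Suc d" for N d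
  proof (rule fps_ext)
    fix k
    have 0: "fl_comp d (fps_nth (?u n) k) = 0" if "n > d \<or> n > k" for n
      using that t[of n] o[of n k] by (auto simp: t_ord_ge_def fl_ord_ge_def fl_comp_scale fl_comp.zero)
    \<comment> \<open>Both sums are extended to a common range. The terms added to the partial sum
      have n > d and vanish by degree; those added to the t-adic sum have n > k and vanish by
      t-order.\<close>
    have "(\<Sum>n<N. fl_comp d (fps_nth (?u n) k)) = (\<Sum>n<max N (Suc k). fl_comp d (fps_nth (?u n) k))"
      using that 0 by (intro sum.mono_neutral_left) auto
    moreover have "(\<Sum>n\<le>k. fl_comp d (fps_nth (?u n) k)) = (\<Sum>n<max N (Suc k). fl_comp d (fps_nth (?u n) k))"
      using that 0 by (intro sum.mono_neutral_left) auto
    ultimately show "fps_nth (flt_comp d (\<Sum>n<N. ?u n)) k = fps_nth (flt_comp d (t_sum ?u)) k"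
      by (simp add: fps_nth_sum fl_comp.sum t_sum_def del: flt_scale_const_nth)
  qed
  then have "deg_tendsto (\<lambda>N. \<Sum>n<N. ?u n) (t_sum ?u)"
    unfolding deg_tendsto_def eventually_sequentially by blast
  then show ?thesis
    unfolding op_series_def by (intro the_equality deg_tendsto_unique)
qed

lemma fl_ord_ge_ad_pow: "fl_ord_ge n (fps_nth ((flt_br G ^^ n) x) k)"
proof (induction n arbitrary: k)
  case (Suc n)
  then show ?case by (auto simp: flt_br_nth intro!: fl_ord_ge_sum fl_ord_ge_br)
qed (simp add: fl_ord_ge_def)

lemma op_series_ad:
  "fps_nth G 0 = 0 \<Longrightarrow> op_series c (flt_br G) x =
     t_sum (\<lambda>n. flt_scale (fps_const (fps_nth c n)) ((flt_br G ^^ n) x))"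
  by (intro op_series_eq_t_sum t_ord_ge_ad_pow fl_ord_ge_ad_pow)

lemma flt_br_pow_add: "(flt_br G ^^ n) (x + y) = (flt_br G ^^ n) x + (flt_br G ^^ n) y"
  by (induction n) (simp_all add: flt_br_right.add)

interpretation flt_br_pow: additive "flt_br G ^^ n"
  by standard (rule flt_br_pow_add)

lemma flt_br_pow_scale_const:
  "(flt_br G ^^ n) (flt_scale (fps_const c) x) = flt_scale (fps_const c) ((flt_br G ^^ n) x)"
  by (induction n) (simp_all add: flt_br_scale_const)

text \<open>Causality in t: it lets an infinite sum inside a power of ad be replaced by a finite
  one, and turns the differential equation into a recursion.\<close>

lemma flt_br_pow_cong:
  assumes "\<And>i. i \<le> k \<Longrightarrow> fps_nth G i = fps_nth G' i" "\<And>i. i \<le> k \<Longrightarrow> fps_nth x i = fps_nth y i"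
  shows "fps_nth ((flt_br G ^^ n) x) k = fps_nth ((flt_br G' ^^ n) y) k"
  using assms
proof (induction n arbitrary: k)
  case (Suc n)
  show ?case
    unfolding funpow.simps o_apply flt_br_nth
    by (rule sum.cong) (use Suc in auto)
qed simp

text \<open>Substituting ad G is multiplicative, so inverse power series give inverse operators. For
  fixed k the inner sum may be cut at k before the double sum is rearranged.\<close>

lemma op_series_ad_compose:
  assumes G: "fps_nth G 0 = 0"
  shows "op_series c (flt_br G) (op_series d (flt_br G) x) = op_series (c * d) (flt_br G) x"
proof (rule fps_ext)
  fix k
  let ?A = "\<lambda>n. flt_br G ^^ n"
  let ?v = "\<lambda>n. flt_scale (fps_const (fps_nth d n)) (?A n x)"
  have v: "t_ord_ge n (?v n)" for n
    by (intro t_ord_ge_scale_const t_ord_ge_ad_pow G)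
  have "fps_nth (?A m (t_sum ?v)) k = (\<Sum>j\<le>k. fl_scale (fps_nth d j) (fps_nth (?A (m + j) x) k))" for m
  proof -
    have "fps_nth (?A m (t_sum ?v)) k = fps_nth (?A m (\<Sum>j\<le>k. ?v j)) k"
      by (rule flt_br_pow_cong) (simp_all only: t_sum_nth_bound[OF v] fps_nth_sum)
    then show ?thesis
      by (simp add: flt_br_pow.sum flt_br_pow_scale_const fps_nth_sum funpow_add)
  qed
  then have "fps_nth (op_series c (flt_br G) (op_series d (flt_br G) x)) k =
     (\<Sum>i\<le>k. \<Sum>j\<le>k. fl_scale (fps_nth c i * fps_nth d j) (fps_nth (?A (i + j) x) k))"
    unfolding op_series_ad[OF G] by (subst t_sum_def) (simp add: fl.scale_sum_right)
  also have "\<dots> = (\<Sum>(i, j)\<in>{..k} \<times> {..k}. fl_scale (fps_nth c i * fps_nth d j) (fps_nth (?A (i + j) x) k))"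
    by (rule sum.cartesian_product)
  also have "\<dots> = (\<Sum>(i, j)\<in>{(i, j). i + j \<le> k}. fl_scale (fps_nth c i * fps_nth d j) (fps_nth (?A (i + j) x) k))"
    using t_ord_ge_ad_pow[OF G] by (intro sum.mono_neutral_right) (auto simp: t_ord_ge_def, meson not_le)
  also have "\<dots> = (\<Sum>n\<le>k. \<Sum>i\<le>n. fl_scale (fps_nth c i * fps_nth d (n - i)) (fps_nth (?A (i + (n - i)) x) k))"
    by (rule sum.triangle_reindex_eq)
  also have "\<dots> = fps_nth (op_series (c * d) (flt_br G) x) k"
    by (simp add: op_series_ad[OF G] t_sum_def fps_mult_nth fl.scale_sum_left atLeast0AtMost)
  finally show "fps_nth (op_series c (flt_br G) (op_series d (flt_br G) x)) k =
    fps_nth (op_series (c * d) (flt_br G) x) k" .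
qed

lemma op_series_ad_one:
  assumes "fps_nth G 0 = 0"
  shows "op_series 1 (flt_br G) x = x"
proof (rule fps_ext)
  fix k
  have "(\<Sum>n\<le>k. fl_scale (fps_nth 1 n) (fps_nth ((flt_br G ^^ n) x) k)) =
      (\<Sum>n\<le>k. if n = 0 then fps_nth x k else 0)"
    by (rule sum.cong) auto
  then show "fps_nth (op_series 1 (flt_br G) x) k = fps_nth x k"
    by (simp add: op_series_ad[OF assms] t_sum_def)
qed

subsection \<open>The derivative of the exponential\<close>

text \<open>The series of (exp z - 1) / z, in a form that shows its constant term 1.\<close>

definition fps_expm1_quot :: "rat fps" where
  "fps_expm1_quot = Abs_fps (\<lambda>n. 1 / fact (Suc n))"

text \<open>The divisor \<open>fps_exp 1 - 1\<close> is no unit; after cancelling the common factor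
  \<open>fps_X\<close>, division becomes inversion.\<close>

lemma fps_expm1_quot_mult: "fps_expm1_quot * (fps_X / (fps_exp 1 - 1)) = 1"
proof -
  have "fps_exp 1 - 1 = fps_expm1_quot * fps_X"
  proof (rule fps_ext)
    fix n
    show "fps_nth (fps_exp 1 - 1) n = fps_nth (fps_expm1_quot * fps_X) n"
      by (cases n) (simp_all add: fps_expm1_quot_def distrib_right)
  qed
  then have "fps_X / (fps_exp 1 - 1) = (1 * fps_X) / (fps_expm1_quot * fps_X)"
    by simp
  also have "\<dots> = 1 / fps_expm1_quot"
    by (rule fps_divide_cancel) simp
  also have "\<dots> = inverse fps_expm1_quot"
    by (simp add: fps_divide_unit fps_expm1_quot_def)
  finally show ?thesis
    by (simp add: inverse_mult_eq_1' fps_expm1_quot_def)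
qed

text \<open>
  The terms \<open>y\<close> and \<open>p\<close> are the coefficients of \<open>s\<close> in \<open>exp (s ad G) a\<close> and, shifted by one, in
  \<open>((exp (s ad G) - 1) / ad G) G'\<close>. The induction compares coefficients of \<open>s\<close> in the linear
  equation \<open>\<partial>\<^sub>s z = [G, z]\<close>, which the difference of the two sides satisfies.
\<close>

lemma flt_ddt_exp_ad_term:
  fixes G a
  defines "y \<equiv> \<lambda>n. flt_scale (fps_const (1 / fact n)) ((flt_br G ^^ n) (fps_const a))"
    and "p \<equiv> \<lambda>n. flt_scale (fps_const (1 / fact (Suc n))) ((flt_br G ^^ n) (flt_ddt G))"
  shows "flt_ddt (y (Suc n)) = (\<Sum>i\<le>n. flt_br (p i) (y (n - i)))"
proof -
  \<comment> \<open>The leading zero makes \<open>q n\<close> the coefficient of s^n, so that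
    \<open>q\<close> obeys \<partial>q/\<partial>s = [G, q] + G', with G' entering only at n =
    0.\<close>
  define q where "q = (\<lambda>n. case n of 0 \<Rightarrow> 0 | Suc m \<Rightarrow> p m)"
  let ?s = "\<lambda>n. flt_scale (fps_const (of_nat n))"
  have fact: "of_nat (Suc n) * (1 / fact (Suc n)) = (1 / fact n :: rat)" for n
    by (simp add: field_simps del: of_nat_Suc)
  have y: "?s (Suc n) (y (Suc n)) = flt_br G (y n)" for n
    unfolding y_def flt.scale_scale fact by (simp add: flt_br_scale_const)
  have q: "?s (Suc n) (q (Suc n)) = flt_br G (q n) + (if n = 0 then flt_ddt G else 0)" for n
  proof (cases n)
    case (Suc m)
    then show ?thesis
      unfolding q_def Suc nat.case p_def flt.scale_scale fact by (simp add: flt_br_scale_const)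
  qed (simp add: q_def p_def flt_br_right.zero)
  have "flt_ddt (y n) = (\<Sum>i\<le>n. flt_br (q i) (y (n - i)))" for n
  proof (induction n)
    case 0
    show ?case by (simp add: y_def q_def flt_ddt_scale_const flt_br_left.zero)
  next
    case (Suc n)
    have "?s (Suc n) (flt_ddt (y (Suc n))) = flt_ddt (flt_br G (y n))"
      by (simp only: flt_ddt_scale_const[symmetric] y)
    also have "\<dots> = flt_br (flt_ddt G) (y n) +
        (\<Sum>i\<le>n. flt_br (flt_br G (q i)) (y (n - i))) + (\<Sum>i\<le>n. flt_br (q i) (flt_br G (y (n - i))))"
      by (simp add: flt_ddt_br Suc flt_br_right.sum flt_br_leibniz[of G] sum.distrib add.assoc)
    also have "flt_br (flt_ddt G) (y n) + (\<Sum>i\<le>n. flt_br (flt_br G (q i)) (y (n - i))) =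
        (\<Sum>i\<le>n. (if i = 0 then flt_br (flt_ddt G) (y n) else 0) + flt_br (flt_br G (q i)) (y (n - i)))"
      by (simp add: sum.distrib)
    also have "\<dots> = (\<Sum>i\<le>n. ?s (Suc i) (flt_br (q (Suc i)) (y (n - i))))"
      by (rule sum.cong)
         (auto simp only: flt_br_scale_const(1)[symmetric] q flt_br_left.add flt_br_left.zero
           add.commute add_0 add_0_right if_True if_False diff_zero split: if_split)
    also have "(\<Sum>i\<le>n. flt_br (q i) (flt_br G (y (n - i)))) =
        (\<Sum>i\<le>n. ?s (Suc (n - i)) (flt_br (q i) (y (Suc (n - i)))))"
      by (simp only: flt_br_scale_const(2)[symmetric] y)
    \<comment> \<open>This is the product rule for d/ds: the index of the families \<open>q\<close>
      and \<open>y\<close> is the exponent of s.\<close>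
    also have "(\<Sum>i\<le>n. ?s (Suc i) (flt_br (q (Suc i)) (y (n - i)))) + \<dots> =
        ?s (Suc n) (\<Sum>i\<le>Suc n. flt_br (q i) (y (Suc n - i)))"
      by (rule flt.convolution_product_rule[symmetric])
    finally show ?case
      by (rule flt.scale_left_imp_eq[rotated]) (simp del: of_nat_Suc)
  qed
  from this[of "Suc n"] show ?thesis
    by (simp add: sum.atMost_Suc_shift q_def flt_br_left.zero del: sum.atMost_Suc)
qed

text \<open>Setting s = 1 sums the termwise identity over n, and the convolution on its right
  becomes a bracket by \<open>t_sum_br\<close>.\<close>

lemma flt_ddt_exp_ad:
  assumes G: "fps_nth G 0 = 0"
  shows "flt_ddt (op_series (fps_exp 1) (flt_br G) (fps_const a)) =
    flt_br (op_series fps_expm1_quot (flt_br G) (flt_ddt G))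
      (op_series (fps_exp 1) (flt_br G) (fps_const a))"
proof -
  let ?y = "\<lambda>n. flt_scale (fps_const (1 / fact n)) ((flt_br G ^^ n) (fps_const a))"
  let ?p = "\<lambda>n. flt_scale (fps_const (1 / fact (Suc n))) ((flt_br G ^^ n) (flt_ddt G))"
  have Y: "op_series (fps_exp 1) (flt_br G) (fps_const a) = t_sum ?y"
    by (simp add: op_series_ad[OF G])
  have P: "op_series fps_expm1_quot (flt_br G) (flt_ddt G) = t_sum ?p"
    by (simp add: op_series_ad[OF G] fps_expm1_quot_def del: fact_Suc)
  have ord: "t_ord_ge n (?y n)" "t_ord_ge n (?p n)" for n
    by (intro t_ord_ge_scale_const t_ord_ge_ad_pow G)+
  \<comment> \<open>Differentiation costs one t-order. The n = 0 term is the constant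
    \<open>a\<close> and drops out, so shifting the index compensates exactly.\<close>
  have "flt_ddt (t_sum ?y) = t_sum (\<lambda>n. flt_ddt (?y (Suc n)))"
  proof (rule fps_ext)
    fix k
    have "fps_nth (flt_ddt (t_sum ?y)) k = (\<Sum>n\<le>Suc k. fps_nth (flt_ddt (?y n)) k)"
      by (simp only: flt_ddt_nth t_sum_nth_bound[OF ord(1) order.refl] fl.scale_sum_right)
    also have "\<dots> = fps_nth (t_sum (\<lambda>n. flt_ddt (?y (Suc n)))) k"
      unfolding t_sum_def sum.atMost_Suc_shift
      by (simp only: flt_ddt_scale_const funpow_0 flt_ddt_const flt.scale_zero_right fps_zero_nth
          add_0 fps_nth_Abs_fps)
    finally show "fps_nth (flt_ddt (t_sum ?y)) k = fps_nth (t_sum (\<lambda>n. flt_ddt (?y (Suc n)))) k" .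
  qed
  also have "\<dots> = flt_br (t_sum ?p) (t_sum ?y)"
    unfolding flt_ddt_exp_ad_term by (rule t_sum_br[OF ord(2,1), symmetric])
  finally show ?thesis by (simp only: Y P)
qed

lemma linear_ode_unique:
  assumes "flt_ddt y = flt_br w y" "flt_ddt z = flt_br w z" "fps_nth y 0 = fps_nth z 0"
  shows "y = z"
proof (rule fps_ext)
  fix k
  show "fps_nth y k = fps_nth z k"
  proof (induction k rule: less_induct)
    case (less k)
    show ?case
    proof (cases k)
      case (Suc j)
      have "fps_nth (flt_ddt y) j = fps_nth (flt_ddt z) j"
        unfolding assms(1,2) flt_br_nth by (rule sum.cong) (use less Suc in auto)
      then show ?thesis
        by (simp add: Suc fl.scale_cancel_left del: of_nat_Suc)
    qed (use assms in simp)
  qed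
qed

section \<open>The flow of a derivation\<close>

locale fl_flow = fl_derivation +
  assumes ord: "fl_ord_ge n x \<Longrightarrow> fl_ord_ge (Suc n) (D x)"
begin

definition Dt :: "'a fl fps \<Rightarrow> 'a fl fps" where
  "Dt x = Abs_fps (\<lambda>k. D (fps_nth x k))"

text \<open>This is exp(-tD) with each t-coefficient written as a finite sum, so its algebra
  involves no limits.\<close>

definition flow :: "'a fl fps \<Rightarrow> 'a fl fps" where
  "flow x = Abs_fps (\<lambda>k. \<Sum>i\<le>k. fl_scale ((- 1) ^ i / fact i) ((D ^^ i) (fps_nth x (k - i))))"

lemma Dt_nth [simp]: "fps_nth (Dt x) k = D (fps_nth x k)"
  by (simp add: Dt_def)

lemma flow_nth: "fps_nth (flow x) k =
    (\<Sum>i\<le>k. fl_scale ((- 1) ^ i / fact i) ((D ^^ i) (fps_nth x (k - i))))"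
  by (simp add: flow_def)

lemma pow_add: "(D ^^ n) (x + y) = (D ^^ n) x + (D ^^ n) y"
  by (induction n) (simp_all add: add)

lemma pow_scale: "(D ^^ n) (fl_scale c x) = fl_scale c ((D ^^ n) x)"
  by (induction n) (simp_all add: scale)

lemma pow_ord: "fl_ord_ge m x \<Longrightarrow> fl_ord_ge (n + m) ((D ^^ n) x)"
  by (induction n) (simp_all add: ord)

lemma flow_add: "flow (x + y) = flow x + flow y"
  by (simp add: fps_eq_iff flow_nth pow_add fl.scale_right_distrib sum.distrib)

sublocale flow: additive flow
  by standard (rule flow_add)

lemma flow_nth_0: "fps_nth (flow x) 0 = fps_nth x 0"
  by (simp add: flow_nth)

lemma Dt_br: "Dt (flt_br x y) = flt_br (Dt x) y + flt_br x (Dt y)"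
  by (simp add: fps_eq_iff flt_br_nth sum br sum.distrib)

lemma Dt_scale: "Dt (flt_scale c x) = flt_scale c (Dt x)"
  by (simp add: fps_eq_iff flt_scale_nth sum scale)

lemma Dt_flow: "Dt (flow x) = flow (Dt x)"
  by (simp add: fps_eq_iff flow_nth sum scale funpow_swap1)

text \<open>The argument may itself depend on t. In the product rule the exponential factors give
  -D, the coefficients of \<open>x\<close> give the derivative of \<open>x\<close>.\<close>

lemma flt_ddt_flow: "flt_ddt (flow x) = flow (flt_ddt x) - Dt (flow x)"
proof (rule fps_ext)
  fix k
  let ?b = "\<lambda>i j. fl_scale ((- 1) ^ i / fact i) ((D ^^ i) (fps_nth x j))"
  have "of_nat (Suc i) * ((- 1) ^ Suc i / fact (Suc i)) = - ((- 1) ^ i / fact i :: rat)" for i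
    by (simp add: field_simps del: of_nat_Suc)
  then have "fl_scale (of_nat (Suc i)) (?b (Suc i) j) = - D (?b i j)" for i j
    unfolding fl.scale_scale by (simp add: scale del: of_nat_Suc power_Suc fact_Suc)
  moreover have "fl_scale (of_nat (Suc j)) (?b i (Suc j)) =
      fl_scale ((- 1) ^ i / fact i) ((D ^^ i) (fps_nth (flt_ddt x) j))" for i j
    by (simp add: pow_scale mult.commute del: of_nat_Suc)
  ultimately show "fps_nth (flt_ddt (flow x)) k = fps_nth (flow (flt_ddt x) - Dt (flow x)) k"
    using fl.convolution_product_rule[of k ?b]
    by (simp only: flow_nth flt_ddt_nth fps_sub_nth Dt_nth sum sum_negf) simp
qed

text \<open>
  The defect of multiplicativity \<open>Z(x, y)\<close> satisfies \<open>Z(x, y)' = Z(x', y) + Z(x, y') - D Z(x, y)\<close>, so its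
  coefficients vanish one after the other.
\<close>

lemma flow_br: "flow (flt_br x y) = flt_br (flow x) (flow y)"
proof (rule fps_ext)
  fix k
  show "fps_nth (flow (flt_br x y)) k = fps_nth (flt_br (flow x) (flow y)) k"
  \<comment> \<open>The step applies the hypothesis to (x', y) and (x, y') as well as to (x, y),
    hence the generalisation.\<close>
  proof (induction k arbitrary: x y)
    case 0
    show ?case by (simp add: flow_nth_0 flt_br_nth)
  next
    case (Suc k)
    have "flt_ddt (flow (flt_br x y)) =
        flow (flt_br (flt_ddt x) y) + flow (flt_br x (flt_ddt y)) - Dt (flow (flt_br x y))"
      by (simp add: flt_ddt_flow flt_ddt_br flow_add)
    then have "fps_nth (flt_ddt (flow (flt_br x y))) k =
        fps_nth (flt_br (flow (flt_ddt x)) (flow y) + flt_br (flow x) (flow (flt_ddt y)) -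
          Dt (flt_br (flow x) (flow y))) k"
      by (simp add: Suc del: flt_ddt_nth)
    also have "flt_br (flow (flt_ddt x)) (flow y) + flt_br (flow x) (flow (flt_ddt y)) -
          Dt (flt_br (flow x) (flow y)) = flt_ddt (flt_br (flow x) (flow y))"
      by (simp add: flt_ddt_br flt_ddt_flow Dt_br flt_br_left.diff flt_br_right.diff)
    finally show ?case
      by (simp del: of_nat_Suc)
  qed
qed

text \<open>The scalar is a series in t, so the argument for brackets is repeated with the
  derivative of \<open>c\<close> in place of that of \<open>x\<close>.\<close>

lemma flow_scale: "flow (flt_scale c x) = flt_scale c (flow x)"
proof (rule fps_ext)
  fix k
  show "fps_nth (flow (flt_scale c x)) k = fps_nth (flt_scale c (flow x)) k"
  proof (induction k arbitrary: c x)
    case 0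
    show ?case by (simp add: flow_nth_0 flt_scale_nth)
  next
    case (Suc k)
    have "flt_ddt (flow (flt_scale c x)) =
        flow (flt_scale (fps_deriv c) x) + flow (flt_scale c (flt_ddt x)) - Dt (flow (flt_scale c x))"
      by (simp add: flt_ddt_flow flt_ddt_scale flow_add)
    then have "fps_nth (flt_ddt (flow (flt_scale c x))) k =
        fps_nth (flt_scale (fps_deriv c) (flow x) + flt_scale c (flow (flt_ddt x)) -
          Dt (flt_scale c (flow x))) k"
      by (simp add: Suc del: flt_ddt_nth)
    also have "flt_scale (fps_deriv c) (flow x) + flt_scale c (flow (flt_ddt x)) -
          Dt (flt_scale c (flow x)) = flt_ddt (flt_scale c (flow x))"
      by (simp add: flt_ddt_scale flt_ddt_flow Dt_scale flt_scale.diff)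
    finally show ?case
      by (simp del: of_nat_Suc)
  qed
qed

lemma flow_ord: "(\<And>k. fl_ord_ge n (fps_nth x k)) \<Longrightarrow> fl_ord_ge n (fps_nth (flow x) k)"
  unfolding flow_nth
  by (intro fl_ord_ge_sum fl_ord_ge_scale) (rule fl_ord_ge_mono[OF pow_ord], auto)

lemma op_series_flow: "op_series (fps_exp 1) (\<lambda>x. flt_scale (- fps_X) (Dt x)) x = flow x"
proof -
  let ?P = "\<lambda>x. flt_scale (- fps_X) (Dt x)"
  have nth: "fps_nth ((?P ^^ n) x) k =
      (if k < n then 0 else fl_scale ((- 1) ^ n) ((D ^^ n) (fps_nth x (k - n))))" for n k
  proof (induction n arbitrary: k)
    case (Suc n)
    then show ?case
      by (auto simp: flt_scale_uminus_X_nth scale zero split: nat.splits)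
  qed simp
  have "op_series (fps_exp 1) ?P x = t_sum (\<lambda>n. flt_scale (fps_const (fps_nth (fps_exp 1) n)) ((?P ^^ n) x))"
  proof (rule op_series_eq_t_sum)
    show "t_ord_ge n ((?P ^^ n) x)" for n
      by (simp add: t_ord_ge_def nth)
    show "fl_ord_ge n (fps_nth ((?P ^^ n) x) k)" for n k
      using pow_ord[of 0 _ n] by (auto simp: nth fl_ord_ge_def fl_comp.zero fl_comp_scale)
  qed
  also have "\<dots> = flow x"
    by (auto simp: fps_eq_iff t_sum_def flow_nth nth intro!: sum.cong)
  finally show ?thesis .
qed

end

section \<open>Series over S and causal fixed points\<close>

lemma FLt_nth: "x \<in> FLt S \<Longrightarrow> fps_nth x k \<in> FL S"
  by (simp add: FLt_def)

lemma FLt_const: "a \<in> FL S \<Longrightarrow> fps_const a \<in> FLt S"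
  by (simp add: FLt_def FL_zero)

lemma FLt_add: "x \<in> FLt S \<Longrightarrow> y \<in> FLt S \<Longrightarrow> x + y \<in> FLt S"
  by (simp add: FLt_def FL_add)

lemma FLt_diff: "x \<in> FLt S \<Longrightarrow> y \<in> FLt S \<Longrightarrow> x - y \<in> FLt S"
  by (simp add: FLt_def FL_diff)

lemma FLt_zero: "0 \<in> FLt S"
  by (simp add: FLt_def FL_zero)

lemma FLt_sum: "(\<And>i. i \<in> I \<Longrightarrow> f i \<in> FLt S) \<Longrightarrow> sum f I \<in> FLt S"
  by (simp add: FLt_def fps_nth_sum FL_sum)

lemma FLt_br: "x \<in> FLt S \<Longrightarrow> y \<in> FLt S \<Longrightarrow> flt_br x y \<in> FLt S"
  by (auto simp: FLt_def flt_br_nth intro!: FL_sum FL_br)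

lemma FLt_scale: "x \<in> FLt S \<Longrightarrow> flt_scale c x \<in> FLt S"
  by (auto simp: FLt_def flt_scale_nth intro!: FL_sum FL_scale)

lemma FLt_ad_pow: "G \<in> FLt S \<Longrightarrow> x \<in> FLt S \<Longrightarrow> (flt_br G ^^ n) x \<in> FLt S"
  by (induction n) (auto intro: FLt_br)

text \<open>Iterating from 0 fixes one more coefficient per step, and the solution is read off the
  diagonal. It solves the differential equation and also inverts the flow.\<close>

lemma causal_fixpoint:
  assumes closed: "\<And>x. x \<in> FLt S \<Longrightarrow> \<Phi> x \<in> FLt S"
    and causal: "\<And>x y k. (\<And>i. i < k \<Longrightarrow> fps_nth x i = fps_nth y i) \<Longrightarrow>
      fps_nth (\<Phi> x) k = fps_nth (\<Phi> y) k"
  shows "\<exists>!x. x \<in> FLt S \<and> \<Phi> x = x"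
proof (rule ex_ex1I)
  let ?g = "\<lambda>n. (\<Phi> ^^ n) 0"
  \<comment> \<open>Iterate k + 1 is the first whose coefficient of t^k is guaranteed to be
    final.\<close>
  define x where "x = Abs_fps (\<lambda>k. fps_nth (?g (Suc k)) k)"
  have g: "?g n \<in> FLt S" for n
    by (induction n) (auto intro: FLt_zero closed)
  have step: "k < n \<Longrightarrow> fps_nth (?g (Suc n)) k = fps_nth (?g n) k" for n k
  proof (induction n arbitrary: k)
    case (Suc n)
    then show ?case by (simp del: funpow.simps add: funpow.simps(2)[of _ \<Phi>]) (rule causal, simp)
  qed simp
  have agree: "fps_nth (?g n) k = fps_nth x k" if "k < n" for n k
    using that
  proof (induction n)
    case (Suc n)
    then show ?case
      by (cases "k = n") (simp_all add: x_def step del: funpow.simps)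
  qed simp
  have "fps_nth (\<Phi> x) k = fps_nth x k" for k
  proof -
    have "fps_nth (\<Phi> x) k = fps_nth (\<Phi> (?g k)) k"
      by (rule causal) (simp add: agree)
    then show ?thesis by (simp add: x_def)
  qed
  then have "\<Phi> x = x" by (rule fps_ext)
  moreover have "x \<in> FLt S"
    using g by (auto simp: FLt_def x_def simp del: funpow.simps)
  ultimately show "\<exists>x. x \<in> FLt S \<and> \<Phi> x = x" by blast
next
  fix x y assume xy: "x \<in> FLt S \<and> \<Phi> x = x" "y \<in> FLt S \<and> \<Phi> y = y"
  show "x = y"
  proof (rule fps_ext)
    fix k
    show "fps_nth x k = fps_nth y k"
    proof (induction k rule: less_induct)
      case (less k)
      then have "fps_nth (\<Phi> x) k = fps_nth (\<Phi> y) k" by (rule causal)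
      then show ?case using xy by simp
    qed
  qed
qed

text \<open>Integrating in t shifts coefficients by one, so the integrated equation is a causal
  fixed point problem.\<close>

lemma ad_ode_ex1:
  assumes "w \<in> FLt S"
  shows "\<exists>!G. G \<in> FLt S \<and> fps_nth G 0 = 0 \<and> flt_ddt G = op_series c (flt_br G) w"
proof -
  \<comment> \<open>The explicit sum replaces \<open>op_series\<close>, with which it is known to
    agree when the constant term of \<open>G\<close> is zero; causality of \<open>\<Phi>\<close> is
    required for all series.\<close>
  define R where "R = (\<lambda>G. t_sum (\<lambda>n. flt_scale (fps_const (fps_nth c n)) ((flt_br G ^^ n) w)))"
  define \<Phi> where "\<Phi> = (\<lambda>G. Abs_fps (\<lambda>k. case k of 0 \<Rightarrow> 0 |
    Suc j \<Rightarrow> fl_scale (1 / of_nat (Suc j)) (fps_nth (R G) j)))"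
  have "\<exists>!G. G \<in> FLt S \<and> \<Phi> G = G"
  proof (rule causal_fixpoint)
    fix G assume "G \<in> FLt S"
    then show "\<Phi> G \<in> FLt S"
      using FLt_nth[OF FLt_ad_pow[OF _ assms]]
      by (auto simp: FLt_def \<Phi>_def R_def t_sum_def intro!: FL_zero FL_scale FL_sum split: nat.splits)
  next
    fix x y :: "'a fl fps" and k
    assume *: "\<And>i. i < k \<Longrightarrow> fps_nth x i = fps_nth y i"
    have "fps_nth (R x) j = fps_nth (R y) j" if "k = Suc j" for j
      unfolding R_def t_sum_def fps_nth_Abs_fps flt_scale_const_nth
      by (rule sum.cong[OF refl], rule arg_cong, rule flt_br_pow_cong) (use * that in auto)
    then show "fps_nth (\<Phi> x) k = fps_nth (\<Phi> y) k"
      by (simp add: \<Phi>_def split: nat.splits)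
  qed
  moreover have "\<Phi> G = G \<longleftrightarrow> fps_nth G 0 = 0 \<and> flt_ddt G = op_series c (flt_br G) w" for G
  proof -
    have inv: "fl_scale (1 / of_nat (Suc j)) y = x \<longleftrightarrow> fl_scale (of_nat (Suc j)) x = y"
      for x y :: "'a fl" and j
      by (auto simp del: of_nat_Suc)
    have "\<Phi> G = G \<longleftrightarrow> fps_nth G 0 = 0 \<and> (\<forall>j. fps_nth (\<Phi> G) (Suc j) = fps_nth G (Suc j))"
      unfolding fps_eq_iff by (auto simp: \<Phi>_def split: nat.splits)
    also have "\<dots> \<longleftrightarrow> fps_nth G 0 = 0 \<and> flt_ddt G = R G"
      unfolding \<Phi>_def fps_eq_iff fps_nth_Abs_fps nat.case inv flt_ddt_nth ..
    finally have "\<Phi> G = G \<longleftrightarrow> fps_nth G 0 = 0 \<and> flt_ddt G = R G" .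
    then show ?thesis by (auto simp: R_def op_series_ad)
  qed
  ultimately show ?thesis by simp
qed

section \<open>Uniqueness of derivations and automorphisms with given values on generators\<close>

lemma additive_on_sum:
  assumes add: "\<And>x y. x \<in> A \<Longrightarrow> y \<in> A \<Longrightarrow> F (x + y) = F x + (F y :: 'b :: ab_group_add)"
    and zero: "(0 :: 'c :: ab_group_add) \<in> A"
    and add_closed: "\<And>x y. x \<in> A \<Longrightarrow> y \<in> A \<Longrightarrow> x + y \<in> A"
    and f: "\<And>i. i \<in> I \<Longrightarrow> f i \<in> A"
  shows "F (sum f I) = (\<Sum>i\<in>I. F (f i))"
proof -
  have F0: "F 0 = 0" using add[OF zero zero] by simp
  have "sum f I \<in> A \<and> F (sum f I) = (\<Sum>i\<in>I. F (f i))"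
    using f
  proof (induction I rule: infinite_finite_induct)
    case (insert i I)
    then show ?case using add[of "f i" "sum f I"] add_closed[of "f i" "sum f I"] by simp
  qed (simp_all add: F0 zero)
  then show ?thesis ..
qed

text \<open>The Leibniz rule spreads agreement from generators to monomials and linearity to finite
  combinations. Continuity makes the two images of the remainder as small as desired, and
  separatedness concludes.\<close>

lemma cont_derivation_unique:
  assumes "finite S" "is_cont_derivation S D" "is_cont_derivation S D'"
    and gens: "\<And>a. a \<in> S \<Longrightarrow> D (fl_gen a) = D' (fl_gen a)" and x: "x \<in> FL S"
  shows "D x = D' x"
proof (rule fl_eqI_ord)
  fix n
  have mono: "D (fl_mono T) = D' (fl_mono T)" if "gens T \<subseteq> S" for T
    using that
  proof (induction T)
    case (Br l r)
    then show ?case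
      using assms(2,3) FL_mono[of l S] FL_mono[of r S] by (simp add: fl_mono_Br is_cont_derivation_def)
  qed (simp add: fl_mono_Gen gens)
  obtain e e' where e: "\<And>x. x \<in> FL S \<Longrightarrow> fl_ord_ge e x \<Longrightarrow> fl_ord_ge n (D x)"
    and e': "\<And>x. x \<in> FL S \<Longrightarrow> fl_ord_ge e' x \<Longrightarrow> fl_ord_ge n (D' x)"
    using assms(2,3) unfolding is_cont_derivation_def fl_ord_ge_def by metis
  obtain c where c: "fl_ord_ge (max e e') (x - (\<Sum>T\<in>low_monos S (max e e'). fl_scale (c T) (fl_mono T)))"
    using FL_expand[OF assms(1) x] by blast
  define s where "s = (\<Sum>T\<in>low_monos S (max e e'). fl_scale (c T) (fl_mono T))"
  have T: "fl_mono T \<in> FL S" "gens T \<subseteq> S" if "T \<in> low_monos S (max e e')" for T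
    using that by (auto simp: low_monos_def intro: FL_mono)
  have s: "s \<in> FL S" "x - s \<in> FL S"
    unfolding s_def using T x by (auto intro!: FL_sum FL_scale FL_diff)
  have "D s = (\<Sum>T\<in>low_monos S (max e e'). D (fl_scale (c T) (fl_mono T)))"
    unfolding s_def using assms(2) T
    by (intro additive_on_sum[of "FL S"] FL_zero FL_add FL_scale) (auto simp: is_cont_derivation_def)
  also have "\<dots> = (\<Sum>T\<in>low_monos S (max e e'). D' (fl_scale (c T) (fl_mono T)))"
    using assms(2,3) T mono by (intro sum.cong) (auto simp: is_cont_derivation_def)
  also have "\<dots> = D' s"
    unfolding s_def using assms(3) T
    by (intro additive_on_sum[of "FL S", symmetric] FL_zero FL_add FL_scale) (auto simp: is_cont_derivation_def)
  finally have "D s = D' s" .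
  moreover have "D x = D s + D (x - s)" "D' x = D' s + D' (x - s)"
    using assms(2,3) s unfolding is_cont_derivation_def by (metis add_diff_cancel_left' add_diff_eq)+
  ultimately have "D x - D' x = D (x - s) + fl_scale (- 1) (D' (x - s))"
    by simp
  moreover have "fl_ord_ge n (D (x - s))" "fl_ord_ge n (D' (x - s))"
    using c s by (auto intro!: e e' fl_ord_ge_mono[OF c[folded s_def]])
  ultimately show "fl_ord_ge n (D x - D' x)"
    by (auto intro: fl_ord_ge_add fl_ord_ge_scale simp del: fl.scale_minus_left)
qed

lemma flt_scale_of_const_nth: "fps_nth (flt_scale c (fps_const a)) k = fl_scale (fps_nth c k) a"
proof -
  have "fps_nth (flt_scale c (fps_const a)) k = (\<Sum>i\<le>k. if i = k then fl_scale (fps_nth c k) a else 0)"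
    unfolding flt_scale_nth by (rule sum.cong) auto
  then show ?thesis by simp
qed

lemma flt_br_const: "flt_br (fps_const a) (fps_const b) = fps_const (fl_br a b)"
proof (rule fps_ext)
  fix k
  have "fps_nth (flt_br (fps_const a) (fps_const b)) k = (\<Sum>i\<le>k. if i = 0 then if k = 0 then fl_br a b else 0 else 0)"
    unfolding flt_br_nth by (rule sum.cong) (auto simp: fl_br_left.zero fl_br_right.zero)
  then show "fps_nth (flt_br (fps_const a) (fps_const b)) k = fps_nth (fps_const (fl_br a b)) k" by simp
qed

text \<open>Coefficients chosen for each power of t are collected into one scalar series per
  monomial. The sum stays finite, so linearity over \<open>rat fps\<close> can be applied to
  it.\<close>

lemma FLt_expand:
  assumes "finite S" "x \<in> FLt S"
  obtains c where "\<And>k. fl_ord_ge n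
    (fps_nth (x - (\<Sum>T\<in>low_monos S n. flt_scale (c T) (fps_const (fl_mono T)))) k)"
proof -
  have "\<exists>c. fl_ord_ge n (fps_nth x k - (\<Sum>T\<in>low_monos S n. fl_scale (c T) (fl_mono T)))" for k
    using FL_expand[OF assms(1) FLt_nth[OF assms(2)]] by blast
  then obtain c where "\<And>k. fl_ord_ge n (fps_nth x k - (\<Sum>T\<in>low_monos S n. fl_scale (c k T) (fl_mono T)))"
    by metis
  then show ?thesis
    by (intro that[of "\<lambda>T. Abs_fps (\<lambda>k. c k T)"]) (simp add: fps_nth_sum flt_scale_of_const_nth)
qed

lemma cont_automorphism_unique:
  assumes "finite S" "is_cont_automorphism S F" "is_cont_automorphism S F'"
    and gens: "\<And>a. a \<in> S \<Longrightarrow> F (fps_const (fl_gen a)) = F' (fps_const (fl_gen a))" and x: "x \<in> FLt S"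
  shows "F x = F' x"
proof (rule fps_ext, rule fl_eqI_ord)
  fix n k
  have mono: "F (fps_const (fl_mono T)) = F' (fps_const (fl_mono T))" if "gens T \<subseteq> S" for T
    using that
  proof (induction T)
    case (Br l r)
    then show ?case
      using assms(2,3) FLt_const[OF FL_mono[of l S]] FLt_const[OF FL_mono[of r S]]
      by (simp add: fl_mono_Br flt_br_const[symmetric] is_cont_automorphism_def)
  qed (simp add: fl_mono_Gen gens)
  \<comment> \<open>A neighbourhood of zero bounds the degree order uniformly in all powers of
    t.\<close>
  have comp: "(\<forall>i<m. flt_comp i y = 0) \<longleftrightarrow> (\<forall>k. fl_ord_ge m (fps_nth y k))" for m and y :: "'a fl fps"
    by (auto simp: fl_ord_ge_def fps_eq_iff)
  obtain e e' where e: "\<And>x k. x \<in> FLt S \<Longrightarrow> (\<And>k. fl_ord_ge e (fps_nth x k)) \<Longrightarrow> fl_ord_ge n (fps_nth (F x) k)"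
    and e': "\<And>x k. x \<in> FLt S \<Longrightarrow> (\<And>k. fl_ord_ge e' (fps_nth x k)) \<Longrightarrow> fl_ord_ge n (fps_nth (F' x) k)"
    using assms(2,3) unfolding is_cont_automorphism_def comp by metis
  let ?L = "low_monos S (max e e')"
  obtain c where c: "\<And>k. fl_ord_ge (max e e') (fps_nth (x - (\<Sum>T\<in>?L. flt_scale (c T) (fps_const (fl_mono T)))) k)"
    using FLt_expand[OF assms(1) x] by blast
  define s where "s = (\<Sum>T\<in>?L. flt_scale (c T) (fps_const (fl_mono T)))"
  have T: "fps_const (fl_mono T) \<in> FLt S" "gens T \<subseteq> S" if "T \<in> ?L" for T
    using that by (auto simp: low_monos_def intro: FLt_const FL_mono)
  have s: "s \<in> FLt S" "x - s \<in> FLt S"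
    unfolding s_def using T x by (auto intro!: FLt_sum FLt_scale FLt_diff)
  have "F s = (\<Sum>T\<in>?L. F (flt_scale (c T) (fps_const (fl_mono T))))"
    unfolding s_def using assms(2) T
    by (intro additive_on_sum[of "FLt S"] FLt_zero FLt_add FLt_scale) (auto simp: is_cont_automorphism_def)
  also have "\<dots> = (\<Sum>T\<in>?L. F' (flt_scale (c T) (fps_const (fl_mono T))))"
    using assms(2,3) T mono by (intro sum.cong) (auto simp: is_cont_automorphism_def)
  also have "\<dots> = F' s"
    unfolding s_def using assms(3) T
    by (intro additive_on_sum[of "FLt S", symmetric] FLt_zero FLt_add FLt_scale) (auto simp: is_cont_automorphism_def)
  finally have "F s = F' s" .
  moreover have "F x = F s + F (x - s)" "F' x = F' s + F' (x - s)"
    using assms(2,3) s unfolding is_cont_automorphism_def by (metis add_diff_cancel_left' add_diff_eq)+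
  ultimately have "fps_nth (F x) k - fps_nth (F' x) k =
      fps_nth (F (x - s)) k + fl_scale (- 1) (fps_nth (F' (x - s)) k)"
    by simp
  moreover have "fl_ord_ge n (fps_nth (F (x - s)) k)" "fl_ord_ge n (fps_nth (F' (x - s)) k)"
    using s by (auto intro!: e e' fl_ord_ge_mono[OF c[folded s_def]])
  ultimately show "fl_ord_ge n (fps_nth (F x) k - fps_nth (F' x) k)"
    by (auto intro: fl_ord_ge_add fl_ord_ge_scale simp del: fl.scale_minus_left)
qed

section \<open>The flow as a continuous automorphism over S\<close>

context fl_flow
begin

context
  fixes S :: "'a set"
  assumes FL_closed: "\<And>x. x \<in> FL S \<Longrightarrow> D x \<in> FL S"
begin

lemma pow_FL: "x \<in> FL S \<Longrightarrow> (D ^^ n) x \<in> FL S"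
  by (induction n) (auto intro: FL_closed)

lemma flow_FLt: "x \<in> FLt S \<Longrightarrow> flow x \<in> FLt S"
  by (auto simp: FLt_def flow_nth intro!: FL_sum FL_scale pow_FL)

text \<open>Coefficient k of \<open>flow x - x\<close> involves only earlier coefficients of
  \<open>x\<close>, so solving flow x = y is a causal fixed point problem.\<close>

lemma flow_bij_betw: "bij_betw flow (FLt S) (FLt S)"
proof -
  have ex1: "\<exists>!x. x \<in> FLt S \<and> flow x = y" if y: "y \<in> FLt S" for y
  proof -
    have "\<exists>!x. x \<in> FLt S \<and> y - (flow x - x) = x"
    proof (rule causal_fixpoint)
      fix x z :: "'a fl fps" and k
      assume *: "\<And>i. i < k \<Longrightarrow> fps_nth x i = fps_nth z i"
      have "fps_nth (flow u - u) k =
          (\<Sum>i<k. fl_scale ((- 1) ^ Suc i / fact (Suc i)) ((D ^^ Suc i) (fps_nth u (k - Suc i))))" for u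
        by (simp add: flow_nth sum.atMost_shift)
      moreover have "(\<Sum>i<k. fl_scale ((- 1) ^ Suc i / fact (Suc i)) ((D ^^ Suc i) (fps_nth x (k - Suc i)))) =
          (\<Sum>i<k. fl_scale ((- 1) ^ Suc i / fact (Suc i)) ((D ^^ Suc i) (fps_nth z (k - Suc i))))"
        by (rule sum.cong) (use * in auto)
      ultimately have "fps_nth (flow x - x) k = fps_nth (flow z - z) k" by simp
      then show "fps_nth (y - (flow x - x)) k = fps_nth (y - (flow z - z)) k"
        by (simp only: fps_sub_nth)
    qed (intro FLt_diff y flow_FLt)
    moreover have "y - (flow x - x) = x \<longleftrightarrow> flow x = y" for x
      by (auto simp: algebra_simps)
    ultimately show ?thesis by simp
  qed
  show ?thesis
    unfolding bij_betw_def
  proof (intro conjI inj_onI subset_antisym subsetI)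
    fix x y assume "x \<in> FLt S" "y \<in> FLt S" "flow x = flow y"
    then show "x = y" using ex1[OF flow_FLt] by metis
  next
    fix y assume "y \<in> FLt S"
    then show "y \<in> flow ` FLt S" using ex1 by blast
  qed (auto intro: flow_FLt)
qed

lemma flow_cont_automorphism: "is_cont_automorphism S (restrict flow (FLt S))"
  unfolding is_cont_automorphism_def
proof (intro conjI ballI allI)
  show "bij_betw (restrict flow (FLt S)) (FLt S) (FLt S)"
    using flow_bij_betw by simp
  fix d
  show "\<exists>e. \<forall>x\<in>FLt S. (\<forall>i<e. flt_comp i x = 0) \<longrightarrow>
      (\<forall>i<d. flt_comp i (restrict flow (FLt S) x) = 0)"
  proof (intro exI[of _ d] ballI impI allI)
    fix x i assume "x \<in> FLt S" and *: "\<forall>i<d. flt_comp i x = 0" and "i < d"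
    have "fl_ord_ge d (fps_nth (flow x) k)" for k
      using * by (intro flow_ord) (auto simp: fl_ord_ge_def fps_eq_iff)
    then show "flt_comp i (restrict flow (FLt S) x) = 0"
      using \<open>x \<in> FLt S\<close> \<open>i < d\<close> by (simp add: fps_eq_iff fl_ord_ge_def)
  qed
qed (simp_all add: flow_add flow_br flow_scale FLt_add FLt_br FLt_scale)

lemma restrict_cont_derivation: "is_cont_derivation S (restrict D (FL S))"
  unfolding is_cont_derivation_def
proof (intro conjI ballI allI)
  fix d
  show "\<exists>e. \<forall>x\<in>FL S. (\<forall>i<e. fl_comp i x = 0) \<longrightarrow> (\<forall>i<d. fl_comp i (restrict D (FL S) x) = 0)"
    using ord[of d] by (intro exI[of _ d]) (auto simp: fl_ord_ge_def)
qed (simp_all add: FL_closed FL_add FL_scale FL_br add scale br)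

end

end

section \<open>Evaluation of the definite descriptions\<close>

lemma tder_eq_restrict:
  assumes "finite S" "l \<in> S \<rightarrow>\<^sub>E FL S"
  obtains D where "fl_flow D" "\<And>x. x \<in> FL S \<Longrightarrow> D x \<in> FL S"
    "\<And>a. a \<in> S \<Longrightarrow> D (fl_gen a) = fl_br (fl_gen a) (l a)" "tder S l = restrict D (FL S)"
proof -
  have "\<forall>a\<in>S. \<exists>f. l a = abs_fl f \<and> f \<in> mag_alg_hat \<and> (\<forall>T. f T \<noteq> 0 \<longrightarrow> gens T \<subseteq> S)"
    using assms(2) by (auto simp: FL_iff[symmetric])
  then obtain f where f: "\<And>a. a \<in> S \<Longrightarrow> l a = abs_fl (f a) \<and> f a \<in> mag_alg_hat \<and>
      (\<forall>T. f a T \<noteq> 0 \<longrightarrow> gens T \<subseteq> S)"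
    by metis
  \<comment> \<open>The value 0 outside \<open>S\<close> puts every \<open>m a\<close> in
    \<open>mag_alg_hat\<close>, as needed for a derivation of the whole type.\<close>
  define m where "m a = (if a \<in> S then f a else 0)" for a
  have m: "m a \<in> mag_alg_hat" for a
    using f by (simp add: m_def mag_alg_hat_closed)
  define D where "D = fl_der m"
  interpret fl_derivation D
    unfolding D_def by (rule fl_der_derivation[OF m])
  interpret fl_flow D
    by standard (simp add: D_def fl_der_ord[OF m])
  have closed: "D x \<in> FL S" if "x \<in> FL S" for x
    unfolding D_def using f that by (intro fl_der_FL[OF m]) (auto simp: m_def split: if_splits)
  have gen: "D (fl_gen a) = fl_br (fl_gen a) (l a)" if "a \<in> S" for a
    using f that by (simp add: D_def fl_der_gen[OF m]) (simp add: m_def)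
  have "tder S l = restrict D (FL S)"
    unfolding tder_def
  proof (rule the_equality)
    show "restrict D (FL S) \<in> extensional (FL S) \<and> is_cont_derivation S (restrict D (FL S)) \<and>
        (\<forall>a\<in>S. restrict D (FL S) (fl_gen a) = fl_br (fl_gen a) (l a))"
      by (simp add: restrict_cont_derivation[OF closed] FL_gen gen)
  next
    fix D' assume D': "D' \<in> extensional (FL S) \<and> is_cont_derivation S D' \<and>
        (\<forall>a\<in>S. D' (fl_gen a) = fl_br (fl_gen a) (l a))"
    show "D' = restrict D (FL S)"
    proof (rule extensionalityI[of _ "FL S"])
      fix x assume "x \<in> FL S"
      then show "D' x = restrict D (FL S) x"
        using D' cont_derivation_unique[OF assms(1) _ restrict_cont_derivation[OF closed], of D' x]
        by (simp add: FL_gen gen)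
    qed (use D' in auto)
  qed
  then show ?thesis
    using that[of D] closed gen fl_flow_axioms by blast
qed

text \<open>The operators \<open>tder S l\<close> and \<open>D\<close> are matched only on
  \<open>FL S\<close>; since \<open>FLt S\<close> is stable, all iterates starting there coincide,
  and with them the limits.\<close>

lemma exp_minus_t_tder_eq_flow:
  assumes "fl_flow D" "\<And>x. x \<in> FL S \<Longrightarrow> D x \<in> FL S" "tder S l = restrict D (FL S)" "x \<in> FLt S"
  shows "exp_minus_t_tder S l x = fl_flow.flow D x"
proof -
  interpret fl_flow D by fact
  let ?P = "\<lambda>x. flt_scale (- fps_X) (flt_tder S l x)" and ?Q = "\<lambda>x. flt_scale (- fps_X) (Dt x)"
  have Dt: "Dt y \<in> FLt S" "flt_tder S l y = Dt y" if "y \<in> FLt S" for y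
    using that assms(2) by (auto simp: FLt_def fps_eq_iff flt_tder_def assms(3))
  have "(?P ^^ n) x = (?Q ^^ n) x \<and> (?Q ^^ n) x \<in> FLt S" for n
    by (induction n) (auto simp: assms(4) Dt FLt_scale)
  then have "op_series (fps_exp 1) ?P x = op_series (fps_exp 1) ?Q x"
    by (simp add: op_series_def)
  then show ?thesis by (simp add: exp_minus_t_tder_def op_series_flow)
qed

text \<open>The bracket on tuples is componentwise and the driving term does not involve
  \<open>G\<close>, so the system decouples into one scalar-indexed problem for each
  \<open>a\<close>; extensionality fixes the values outside \<open>S\<close>.\<close>

lemma Gamma_t_solves:
  assumes "\<And>a. a \<in> S \<Longrightarrow> exp_minus_t_tder S l (fps_const (l a)) \<in> FLt S"
  shows "Gamma_t S l \<in> (S \<rightarrow>\<^sub>E FLt S) \<and> solves_Gamma_ode S l (Gamma_t S l)"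
  unfolding Gamma_t_def
proof (rule theI'[where P = "\<lambda>G. G \<in> (S \<rightarrow>\<^sub>E FLt S) \<and> solves_Gamma_ode S l G"])
  let ?Q = "\<lambda>a G. G \<in> FLt S \<and> fps_nth G 0 = 0 \<and> flt_ddt G =
    op_series (fps_X / (fps_exp 1 - 1)) (flt_br G) (exp_minus_t_tder S l (fps_const (l a)))"
  have ex1: "\<exists>!G. ?Q a G" if "a \<in> S" for a
    by (rule ad_ode_ex1) (rule assms[OF that])
  have iff: "G \<in> (S \<rightarrow>\<^sub>E FLt S) \<and> solves_Gamma_ode S l G \<longleftrightarrow> G \<in> extensional S \<and> (\<forall>a\<in>S. ?Q a (G a))" for G
    by (auto simp: solves_Gamma_ode_def PiE_def)
  show "\<exists>!G. G \<in> (S \<rightarrow>\<^sub>E FLt S) \<and> solves_Gamma_ode S l G"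
    unfolding iff
  proof (rule ex1I)
    show "(\<lambda>a\<in>S. THE G. ?Q a G) \<in> extensional S \<and> (\<forall>a\<in>S. ?Q a ((\<lambda>a\<in>S. THE G. ?Q a G) a))"
      using theI'[OF ex1] by simp
    fix G assume G: "G \<in> extensional S \<and> (\<forall>a\<in>S. ?Q a (G a))"
    show "G = (\<lambda>a\<in>S. THE G. ?Q a G)"
    proof (rule extensionalityI[of _ S])
      fix a assume "a \<in> S"
      then have "(THE G. ?Q a G) = G a"
        by (intro the1_equality ex1) (use G in blast)+
      then show "G a = (\<lambda>a\<in>S. THE G. ?Q a G) a"
        using \<open>a \<in> S\<close> by simp
    qed (use G in auto)
  qed
qed

theorem proposition2p6:
  fixes S :: "'a set" and l :: "'a \<Rightarrow> 'a fl"
  assumes "finite S"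
    and "l \<in> (S \<rightarrow>\<^sub>E FL S)"
  shows "\<forall>x\<in>FLt S. exp_minus_t_tder S l x = conj_aut S (Gamma_t S l) x"
proof -
  obtain D where D: "fl_flow D" "\<And>x. x \<in> FL S \<Longrightarrow> D x \<in> FL S"
    "\<And>a. a \<in> S \<Longrightarrow> D (fl_gen a) = fl_br (fl_gen a) (l a)" "tder S l = restrict D (FL S)"
    using tder_eq_restrict[OF assms] by blast
  interpret fl_flow D by (rule D(1))
  note exp_eq = exp_minus_t_tder_eq_flow[OF D(1,2,4)]
  have l: "fps_const (l a) \<in> FLt S" if "a \<in> S" for a
    using assms(2) that by (auto intro: FLt_const)
  define \<Gamma> where "\<Gamma> = Gamma_t S l"
  have "\<Gamma> \<in> (S \<rightarrow>\<^sub>E FLt S) \<and> solves_Gamma_ode S l \<Gamma>"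
    unfolding \<Gamma>_def by (rule Gamma_t_solves) (simp add: exp_eq l flow_FLt[OF D(2)])
  then have \<Gamma>: "fps_nth (\<Gamma> a) 0 = 0"
    "flt_ddt (\<Gamma> a) = op_series (fps_X / (fps_exp 1 - 1)) (flt_br (\<Gamma> a)) (flow (fps_const (l a)))"
    if "a \<in> S" for a
    using that l by (auto simp: solves_Gamma_ode_def exp_eq)
  have gen: "flow (fps_const (fl_gen a)) = op_series (fps_exp 1) (flt_br (\<Gamma> a)) (fps_const (fl_gen a))"
    if a: "a \<in> S" for a
  proof (rule linear_ode_unique)
    let ?w = "flow (fps_const (l a))" and ?Y = "op_series (fps_exp 1) (flt_br (\<Gamma> a)) (fps_const (fl_gen a))"
    \<comment> \<open>Substituting the equation for the derivative of \<open>\<Gamma> a\<close>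
      composes two mutually inverse series in ad.\<close>
    have "op_series fps_expm1_quot (flt_br (\<Gamma> a)) (flt_ddt (\<Gamma> a)) = ?w"
      by (simp only: \<Gamma>[OF a] op_series_ad_compose fps_expm1_quot_mult op_series_ad_one)
    then show "flt_ddt ?Y = flt_br ?w ?Y"
      by (simp add: flt_ddt_exp_ad \<Gamma>(1)[OF a])
    have "Dt (fps_const (fl_gen a)) = flt_br (fps_const (fl_gen a)) (fps_const (l a))"
      by (simp add: flt_br_const fps_eq_iff D(3)[OF a] zero)
    then show "flt_ddt (flow (fps_const (fl_gen a))) = flt_br ?w (flow (fps_const (fl_gen a)))"
      by (simp add: flt_ddt_flow Dt_flow flow_br flow.zero flt_br_swap[of ?w])
    show "fps_nth (flow (fps_const (fl_gen a))) 0 = fps_nth ?Y 0"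
      by (simp add: flow_nth_0 op_series_ad[OF \<Gamma>(1)[OF a]] t_sum_def)
  qed
  \<comment> \<open>By \<open>gen\<close> the flow itself witnesses the existence half of this
    description.\<close>
  have "conj_aut S \<Gamma> = restrict flow (FLt S)"
    unfolding conj_aut_def
  proof (rule the_equality)
    show "restrict flow (FLt S) \<in> extensional (FLt S) \<and> is_cont_automorphism S (restrict flow (FLt S)) \<and>
      (\<forall>a\<in>S. restrict flow (FLt S) (fps_const (fl_gen a)) =
        op_series (fps_exp 1) (flt_br (\<Gamma> a)) (fps_const (fl_gen a)))"
      by (simp add: flow_cont_automorphism[OF D(2)] FLt_const FL_gen gen)
  next
    fix F assume F: "F \<in> extensional (FLt S) \<and> is_cont_automorphism S F \<and>
      (\<forall>a\<in>S. F (fps_const (fl_gen a)) = op_series (fps_exp 1) (flt_br (\<Gamma> a)) (fps_const (fl_gen a)))"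
    show "F = restrict flow (FLt S)"
    proof (rule extensionalityI[of _ "FLt S"])
      fix x assume "x \<in> FLt S"
      then show "F x = restrict flow (FLt S) x"
        using F cont_automorphism_unique[OF assms(1) _ flow_cont_automorphism[OF D(2)], of F x]
        by (simp add: FLt_const FL_gen gen)
    qed (use F in auto)
  qed
  then show ?thesis
    by (simp add: \<Gamma>_def exp_eq)
qed

end
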